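(* Let $K$ be a field and let $A_1,A_2$ be finite-dimensional central-simple $K$-algebras of degree $n$. Suppose a $K$-algebra isomorphism $\varphi:A_1\otimes_K A_2^\circ\to M_{n^2}(K)$ is given, in the form of the pair $(\varphi_1,\varphi_2)$, where $\varphi_1:A_1\to M_{n^2}(K)$, $\varphi_1(a)=\varphi(a\otimes 1)$, and $\varphi_2:A_2\to M_{n^2}(K)$, $\varphi_2(a)=\varphi(1\otimes a)$. Fix a $K$-basis of $A_1$ and use it to identify $M_{n^2}(K)$ with $\mathrm{End}_K(A_1)$. Let $\lambda,\rho:A_1\to \mathrm{End}_K(A_1)$ be the left-regular and right-regular representations, $\lambda(a)(x)=ax$ and $\rho(a)(x)=xa$. Then there exists an invertible $X\in M_{n^2}(K)$ such that $\mathrm{Inn}(X)\circ\varphi_1=\lambda$. For any such $X$, setting $\varphi_2':=\mathrm{Inn}(X)\circ\varphi_2$, one has $\varphi_2'(A_2)=\rho(A_1)$, and the maps $$\chi:=\varphi_2'^{-1}\circ\rho:A_1\to A_2,\qquad \chi':=\rho^{-1}\circ\varphi_2':A_2\to A_1$$ are $K$-algebra isomorphisms.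
   Context: A central-simple $K$-algebra has no proper two-sided ideals and has center $K$; its degree is the square root of its $K$-dimension. $A^\circ$ denotes the opposite algebra of $A$: the same $K$-space with multiplication $a\circ b:=ba$. $\mathrm{Inn}(X)$ denotes the inner automorphism $Y\mapsto XYX^{-1}$. The map $\varphi_1$ is a $K$-algebra embedding, and $\varphi_2$ and $\rho$ are $K$-algebra anti-embeddings (injective $K$-linear maps reversing products). The inverses $\varphi_2'^{-1}$ and $\rho^{-1}$ are taken on the images of the injective maps $\varphi_2'$ and $\rho$. *)

theory Defs
  imports
    "Jordan_Normal_Form.VS_Connect"
    "HOL-Library.Poly_Mapping"
    "HOL-Algebra.QuotRing"
begin

section \<open>Associative algebras over a field\<close>

text \<open>
  Algebras are \<^type>\<open>module_ext\<close>-records of \<open>HOL-Algebra\<close>. The locale \<open>algebra\<close> of \<open>HOL-Algebra\<close>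
  cannot be used because it is restricted to commutative algebras.
\<close>

locale assoc_algebra = A?: ring A + V?: vectorspace K A
  for K :: "'k ring" and A :: "('k, 'a) module" (structure) +
  assumes smult_mult_left:
      "c \<in> carrier K \<Longrightarrow> x \<in> carrier A \<Longrightarrow> y \<in> carrier A \<Longrightarrow>
        (c \<odot> x) \<otimes> y = c \<odot> (x \<otimes> y)"
    and smult_mult_right:
      "c \<in> carrier K \<Longrightarrow> x \<in> carrier A \<Longrightarrow> y \<in> carrier A \<Longrightarrow>
        x \<otimes> (c \<odot> y) = c \<odot> (x \<otimes> y)"

definition ring_center :: "('a, 'm) ring_scheme \<Rightarrow> 'a set" where
  "ring_center R = {z \<in> carrier R. \<forall>x \<in> carrier R. z \<otimes>\<^bsub>R\<^esub> x = x \<otimes>\<^bsub>R\<^esub> z}"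

text \<open>The zero algebra is not simple; in its absence \<open>K\<close> embeds into \<open>A\<close> via \<open>c \<mapsto> c \<cdot> 1\<close>.\<close>

definition central_simple :: "'k ring \<Rightarrow> ('k, 'a) module \<Rightarrow> bool" where
  "central_simple K A \<longleftrightarrow>
     assoc_algebra K A \<and>
     carrier A \<noteq> {\<zero>\<^bsub>A\<^esub>} \<and>
     (\<forall>I. ideal I A \<longrightarrow> I = {\<zero>\<^bsub>A\<^esub>} \<or> I = carrier A) \<and>
     ring_center A = {c \<odot>\<^bsub>A\<^esub> \<one>\<^bsub>A\<^esub> | c. c \<in> carrier K}"

definition algebra_degree :: "'k ring \<Rightarrow> ('k, 'a) module \<Rightarrow> real" where
  "algebra_degree K A = sqrt (real (vectorspace.dim K A))"

definition algebra_iso :: "'k ring \<Rightarrow> ('k, 'a) module \<Rightarrow> ('k, 'b) module \<Rightarrow> ('a \<Rightarrow> 'b) set" where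
  "algebra_iso K A B =
     {h \<in> ring_iso A B. \<forall>c \<in> carrier K. \<forall>x \<in> carrier A. h (c \<odot>\<^bsub>A\<^esub> x) = c \<odot>\<^bsub>B\<^esub> h x}"

definition opposite_algebra :: "('k, 'a) module \<Rightarrow> ('k, 'a) module" where
  "opposite_algebra A = A\<lparr>mult := \<lambda>a b. b \<otimes>\<^bsub>A\<^esub> a\<rparr>"

definition Inn :: "('a, 'm) ring_scheme \<Rightarrow> 'a \<Rightarrow> 'a \<Rightarrow> 'a" where
  "Inn R X Y = X \<otimes>\<^bsub>R\<^esub> Y \<otimes>\<^bsub>R\<^esub> inv\<^bsub>R\<^esub> X"

abbreviation mat_algebra :: "'k::field itself \<Rightarrow> nat \<Rightarrow> ('k, 'k mat) module" where
  "mat_algebra ty N \<equiv> module_mat ty N N"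

lemma assoc_algebraI:
  fixes K :: "'k ring" and A :: "('k, 'a) module" (structure)
  assumes "field K" "ring A"
    and "\<And>c x. c \<in> carrier K \<Longrightarrow> x \<in> carrier A \<Longrightarrow> c \<odot> x \<in> carrier A"
    and "\<And>c d x. c \<in> carrier K \<Longrightarrow> d \<in> carrier K \<Longrightarrow> x \<in> carrier A \<Longrightarrow>
           (c \<oplus>\<^bsub>K\<^esub> d) \<odot> x = c \<odot> x \<oplus> d \<odot> x"
    and "\<And>c x y. c \<in> carrier K \<Longrightarrow> x \<in> carrier A \<Longrightarrow> y \<in> carrier A \<Longrightarrow>
           c \<odot> (x \<oplus> y) = c \<odot> x \<oplus> c \<odot> y"
    and "\<And>c d x. c \<in> carrier K \<Longrightarrow> d \<in> carrier K \<Longrightarrow> x \<in> carrier A \<Longrightarrow>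
           (c \<otimes>\<^bsub>K\<^esub> d) \<odot> x = c \<odot> (d \<odot> x)"
    and "\<And>x. x \<in> carrier A \<Longrightarrow> \<one>\<^bsub>K\<^esub> \<odot> x = x"
    and "\<And>c x y. c \<in> carrier K \<Longrightarrow> x \<in> carrier A \<Longrightarrow> y \<in> carrier A \<Longrightarrow>
           (c \<odot> x) \<otimes> y = c \<odot> (x \<otimes> y)"
    and "\<And>c x y. c \<in> carrier K \<Longrightarrow> x \<in> carrier A \<Longrightarrow> y \<in> carrier A \<Longrightarrow>
           x \<otimes> (c \<odot> y) = c \<odot> (x \<otimes> y)"
  shows "assoc_algebra K A"
proof -
  interpret K: field K by fact
  interpret A: ring A by fact
  have "module K A"
    by (rule moduleI) (use assms K.is_cring A.is_abelian_group in auto)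
  then show ?thesis
    using assms by (auto simp: assoc_algebra_def assoc_algebra_axioms_def vectorspace_def)
qed

lemma assoc_algebra_opposite:
  assumes "assoc_algebra K A"
  shows "assoc_algebra K (opposite_algebra A)"
proof -
  interpret assoc_algebra K A by fact
  have "ring (opposite_algebra A)"
  proof (rule ringI)
    show "abelian_group (opposite_algebra A)"
      by (rule abelian_groupI)
        (use A.a_assoc A.a_comm A.l_neg in \<open>auto simp: opposite_algebra_def\<close>)
    show "Group.monoid (opposite_algebra A)"
      by (rule monoidI) (auto simp: opposite_algebra_def A.m_assoc)
  qed (auto simp: opposite_algebra_def A.l_distr A.r_distr)
  then show ?thesis
    by (intro assoc_algebraI)
      (use field.field_axioms in \<open>auto simp: opposite_algebra_def smult_mult_left smult_mult_right
        smult_l_distr smult_r_distr smult_assoc1\<close>)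
qed

lemma assoc_algebra_mat: "assoc_algebra class_ring (mat_algebra TYPE('k::field) N)"
proof -
  have "ring (mat_algebra TYPE('k) N)"
    using ring_mat[of N "module.fields (\<cdot>\<^sub>m)", where 'a = 'k]
    by (simp add: ring_mat_def module_mat_def module.defs)
  then show ?thesis
    by (intro assoc_algebraI class_field)
      (auto simp: module_mat_simps add_smult_distrib_right_mat add_smult_distrib_left_mat
        mult_smult_assoc_mat mult_smult_distrib)
qed

section \<open>Tensor products of algebras\<close>

text \<open>
  The free vector space on \<open>S \<times> T\<close>, made into the monoid algebra of the product of the
  multiplicative monoids of \<open>A\<close> and \<open>B\<close>.
\<close>

definition pair_conv :: "('p \<Rightarrow> 'p \<Rightarrow> 'p) \<Rightarrow> ('p \<Rightarrow>\<^sub>0 'k::field) \<Rightarrow> ('p \<Rightarrow>\<^sub>0 'k) \<Rightarrow> ('p \<Rightarrow>\<^sub>0 'k)" where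
  "pair_conv m f g = (\<Sum>p \<in> Poly_Mapping.keys f. \<Sum>q \<in> Poly_Mapping.keys g.
     Poly_Mapping.single (m p q) (Poly_Mapping.lookup f p * Poly_Mapping.lookup g q))"

definition pair_algebra ::
    "('k::field, 'a) module \<Rightarrow> ('k, 'b) module \<Rightarrow> ('k, ('a \<times> 'b) \<Rightarrow>\<^sub>0 'k) module" where
  "pair_algebra A B =
    \<lparr>carrier = {f. Poly_Mapping.keys f \<subseteq> carrier A \<times> carrier B},
     mult = pair_conv (\<lambda>(a, b) (a', b'). (a \<otimes>\<^bsub>A\<^esub> a', b \<otimes>\<^bsub>B\<^esub> b')),
     one = Poly_Mapping.single (\<one>\<^bsub>A\<^esub>, \<one>\<^bsub>B\<^esub>) 1,
     zero = 0,
     add = (+),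
     smult = \<lambda>c. Poly_Mapping.map ((*) c)\<rparr>"

definition bilinear_relators ::
    "('k::field, 'a) module \<Rightarrow> ('k, 'b) module \<Rightarrow> (('a \<times> 'b) \<Rightarrow>\<^sub>0 'k) set" where
  "bilinear_relators A B =
     {Poly_Mapping.single (a \<oplus>\<^bsub>A\<^esub> a', b) 1 - Poly_Mapping.single (a, b) 1 - Poly_Mapping.single (a', b) 1
       | a a' b. a \<in> carrier A \<and> a' \<in> carrier A \<and> b \<in> carrier B} \<union>
     {Poly_Mapping.single (a, b \<oplus>\<^bsub>B\<^esub> b') 1 - Poly_Mapping.single (a, b) 1 - Poly_Mapping.single (a, b') 1
       | a b b'. a \<in> carrier A \<and> b \<in> carrier B \<and> b' \<in> carrier B} \<union>
     {Poly_Mapping.single (c \<odot>\<^bsub>A\<^esub> a, b) 1 - Poly_Mapping.single (a, b) c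
       | c a b. a \<in> carrier A \<and> b \<in> carrier B} \<union>
     {Poly_Mapping.single (a, c \<odot>\<^bsub>B\<^esub> b) 1 - Poly_Mapping.single (a, b) c
       | c a b. a \<in> carrier A \<and> b \<in> carrier B}"

text \<open>The linear span of the relators; it is an ideal by \<open>ideal_tensor_relations\<close> below.\<close>

definition tensor_relations ::
    "('k::field, 'a) module \<Rightarrow> ('k, 'b) module \<Rightarrow> (('a \<times> 'b) \<Rightarrow>\<^sub>0 'k) set" where
  "tensor_relations A B =
     LinearCombinations.module.span class_ring (pair_algebra A B) (bilinear_relators A B)"

definition tensor_product ::
    "('k::field, 'a) module \<Rightarrow> ('k, 'b) module \<Rightarrow> ('k, (('a \<times> 'b) \<Rightarrow>\<^sub>0 'k) set) module" where
  "tensor_product A B =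
     ring.extend (pair_algebra A B Quot tensor_relations A B)
       (module.fields (\<lambda>c X. \<Union>x \<in> X. tensor_relations A B +>\<^bsub>pair_algebra A B\<^esub> (c \<odot>\<^bsub>pair_algebra A B\<^esub> x)))"

definition tensor :: "('k::field, 'a) module \<Rightarrow> ('k, 'b) module \<Rightarrow> 'a \<Rightarrow> 'b \<Rightarrow> (('a \<times> 'b) \<Rightarrow>\<^sub>0 'k) set" where
  "tensor A B a b = tensor_relations A B +>\<^bsub>pair_algebra A B\<^esub> Poly_Mapping.single (a, b) 1"

lemma lookup_scale [simp]:
  "Poly_Mapping.lookup (Poly_Mapping.map ((*) c) f) p = (c :: 'k::field) * Poly_Mapping.lookup f p"
  by (simp add: Poly_Mapping.map.rep_eq when_def)

lemma scale_add:
  "Poly_Mapping.map ((*) (c :: 'k::field)) (f + g) = Poly_Mapping.map ((*) c) f + Poly_Mapping.map ((*) c) g"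
  by (rule poly_mapping_eqI) (simp add: lookup_add algebra_simps)

lemma scale_diff:
  "Poly_Mapping.map ((*) (c :: 'k::field)) (f - g) = Poly_Mapping.map ((*) c) f - Poly_Mapping.map ((*) c) g"
  by (rule poly_mapping_eqI) (simp add: lookup_minus algebra_simps)

lemma scale_sum:
  "Poly_Mapping.map ((*) (c :: 'k::field)) (\<Sum>i \<in> I. f i) = (\<Sum>i \<in> I. Poly_Mapping.map ((*) c) (f i))"
  by (rule poly_mapping_eqI) (simp add: lookup_sum sum_distrib_left)

lemma scale_single:
  "Poly_Mapping.map ((*) (c :: 'k::field)) (Poly_Mapping.single p d) = Poly_Mapping.single p (c * d)"
  by (rule poly_mapping_eqI) (simp add: lookup_single when_def)

lemma keys_scale: "Poly_Mapping.keys (Poly_Mapping.map ((*) (c :: 'k::field)) f) \<subseteq> Poly_Mapping.keys f"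
  by (auto simp: in_keys_iff)

lemma keys_sum_subset:
  "(\<And>i. i \<in> I \<Longrightarrow> Poly_Mapping.keys (f i) \<subseteq> S) \<Longrightarrow> Poly_Mapping.keys (\<Sum>i \<in> I. f i) \<subseteq> S"
  by (induction I rule: infinite_finite_induct) (use keys_add in fastforce)+

lemma sum_singles:
  fixes f :: "'p \<Rightarrow>\<^sub>0 'k::field"
  shows "f = (\<Sum>p \<in> Poly_Mapping.keys f. Poly_Mapping.single p (Poly_Mapping.lookup f p))"
proof (rule poly_mapping_eqI)
  fix k
  show "Poly_Mapping.lookup f k =
    Poly_Mapping.lookup (\<Sum>p \<in> Poly_Mapping.keys f. Poly_Mapping.single p (Poly_Mapping.lookup f p)) k"
    by (simp add: lookup_sum lookup_single when_def in_keys_iff)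
qed

lemma finsupp_induct [consumes 1, case_names zero single add]:
  fixes f :: "'p \<Rightarrow>\<^sub>0 'k::field"
  assumes "Poly_Mapping.keys f \<subseteq> S" and "P 0"
    and "\<And>p c. p \<in> S \<Longrightarrow> P (Poly_Mapping.single p c)"
    and "\<And>f g. P f \<Longrightarrow> P g \<Longrightarrow> P (f + g)"
  shows "P f"
proof -
  have "P (\<Sum>p \<in> T. Poly_Mapping.single p (Poly_Mapping.lookup f p))" if "finite T" "T \<subseteq> S" for T
    using that by (induction T rule: finite_induct) (use assms in auto)
  from this[OF _ assms(1)] show ?thesis
    using sum_singles[of f] by simp
qed

lemma pair_conv_superset:
  assumes "finite S" "Poly_Mapping.keys f \<subseteq> S" "finite T" "Poly_Mapping.keys g \<subseteq> T"
  shows "pair_conv m f g = (\<Sum>p \<in> S. \<Sum>q \<in> T.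
     Poly_Mapping.single (m p q) (Poly_Mapping.lookup f p * Poly_Mapping.lookup g q))"
proof -
  have "pair_conv m f g = (\<Sum>p \<in> Poly_Mapping.keys f. \<Sum>q \<in> T.
     Poly_Mapping.single (m p q) (Poly_Mapping.lookup f p * Poly_Mapping.lookup g q))"
    unfolding pair_conv_def
    by (intro sum.cong refl sum.mono_neutral_left) (use assms in \<open>auto simp: in_keys_iff\<close>)
  also have "\<dots> = (\<Sum>p \<in> S. \<Sum>q \<in> T.
     Poly_Mapping.single (m p q) (Poly_Mapping.lookup f p * Poly_Mapping.lookup g q))"
    by (intro sum.mono_neutral_left) (use assms in \<open>auto simp: in_keys_iff\<close>)
  finally show ?thesis .
qed

lemma pair_conv_add_left: "pair_conv m (f + g) h = pair_conv m f h + pair_conv m g h"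
proof -
  let ?S = "Poly_Mapping.keys f \<union> Poly_Mapping.keys g" and ?T = "Poly_Mapping.keys h"
  show ?thesis
    using keys_add[of f g]
    by (simp add: pair_conv_superset[of ?S _ ?T] lookup_add distrib_right single_add sum.distrib)
qed

lemma pair_conv_add_right: "pair_conv m h (f + g) = pair_conv m h f + pair_conv m h g"
proof -
  let ?S = "Poly_Mapping.keys f \<union> Poly_Mapping.keys g" and ?T = "Poly_Mapping.keys h"
  show ?thesis
    using keys_add[of f g]
    by (simp add: pair_conv_superset[of ?T _ ?S] lookup_add distrib_left single_add sum.distrib)
qed

lemma pair_conv_zero [simp]: "pair_conv m 0 f = 0" "pair_conv m f 0 = 0"
  by (simp_all add: pair_conv_def)

lemma pair_conv_uminus: "pair_conv m (- f) g = - pair_conv m f g" "pair_conv m f (- g) = - pair_conv m f g"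
  using pair_conv_add_left[of m f "- f" g] pair_conv_add_right[of m f g "- g"]
  by (auto simp: eq_neg_iff_add_eq_0 add.commute)

lemma pair_conv_diff:
  "pair_conv m (f - g) h = pair_conv m f h - pair_conv m g h"
  "pair_conv m h (f - g) = pair_conv m h f - pair_conv m h g"
  using pair_conv_add_left[of m f "- g" h] pair_conv_add_right[of m h f "- g"]
  by (simp_all add: pair_conv_uminus)

lemma pair_conv_single [simp]:
  "pair_conv m (Poly_Mapping.single p c) (Poly_Mapping.single q d) = Poly_Mapping.single (m p q) (c * d)"
  by (simp add: pair_conv_superset[of "{p}" _ "{q}"])

lemma pair_conv_scale:
  "pair_conv m (Poly_Mapping.map ((*) c) f) g = Poly_Mapping.map ((*) c) (pair_conv m f g)"
  "pair_conv m f (Poly_Mapping.map ((*) c) g) = Poly_Mapping.map ((*) c) (pair_conv m f g)"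
  by (simp_all add: pair_conv_superset[of "Poly_Mapping.keys f" _ "Poly_Mapping.keys g"] keys_scale
      scale_sum scale_single mult.assoc mult.left_commute)

lemma keys_pair_conv:
  assumes "\<And>p q. p \<in> S \<Longrightarrow> q \<in> S \<Longrightarrow> m p q \<in> S"
    "Poly_Mapping.keys f \<subseteq> S" "Poly_Mapping.keys g \<subseteq> S"
  shows "Poly_Mapping.keys (pair_conv m f g) \<subseteq> S"
  unfolding pair_conv_def by (intro keys_sum_subset) (use assms in auto)

lemma pair_conv_assoc:
  assumes m: "\<And>p q r. p \<in> S \<Longrightarrow> q \<in> S \<Longrightarrow> r \<in> S \<Longrightarrow> m (m p q) r = m p (m q r)"
    and "Poly_Mapping.keys f \<subseteq> S" "Poly_Mapping.keys g \<subseteq> S" "Poly_Mapping.keys h \<subseteq> S"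
  shows "pair_conv m (pair_conv m f g) h = pair_conv m f (pair_conv m g h)"
  using assms(2)
proof (induction f rule: finsupp_induct)
  case f: (single p c)
  show ?case
    using assms(3)
  proof (induction g rule: finsupp_induct)
    case g: (single q d)
    show ?case
      using assms(4)
    proof (induction h rule: finsupp_induct)
      case (single r e)
      with f g show ?case by (simp add: m mult.assoc)
    qed (simp_all add: pair_conv_add_right)
  qed (simp_all add: pair_conv_add_left pair_conv_add_right)
qed (simp_all add: pair_conv_add_left)

lemma pair_conv_unit:
  assumes "\<And>p. p \<in> S \<Longrightarrow> m e p = p" "\<And>p. p \<in> S \<Longrightarrow> m p e = p" "Poly_Mapping.keys f \<subseteq> S"
  shows "pair_conv m (Poly_Mapping.single e 1) f = f" "pair_conv m f (Poly_Mapping.single e 1) = f"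
  using assms(3)
  by (induction f rule: finsupp_induct) (simp_all add: assms pair_conv_add_left pair_conv_add_right)

context
  fixes A :: "('k::field, 'a) module" and B :: "('k, 'b) module"
  assumes A: "assoc_algebra class_ring A" and B: "assoc_algebra class_ring B"
begin

interpretation A: assoc_algebra class_ring A by (fact A)
interpretation B: assoc_algebra class_ring B by (fact B)

lemma pair_algebra_simps:
  "carrier (pair_algebra A B) = {f. Poly_Mapping.keys f \<subseteq> carrier A \<times> carrier B}"
  "mult (pair_algebra A B) = pair_conv (\<lambda>(a, b) (a', b'). (a \<otimes>\<^bsub>A\<^esub> a', b \<otimes>\<^bsub>B\<^esub> b'))"
  "one (pair_algebra A B) = Poly_Mapping.single (\<one>\<^bsub>A\<^esub>, \<one>\<^bsub>B\<^esub>) 1"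
  "zero (pair_algebra A B) = 0"
  "add (pair_algebra A B) = (+)"
  "smult (pair_algebra A B) = (\<lambda>c. Poly_Mapping.map ((*) c))"
  by (simp_all add: pair_algebra_def)

lemma ring_pair_algebra: "ring (pair_algebra A B)"
proof (rule ringI)
  show "abelian_group (pair_algebra A B)"
  proof (rule abelian_groupI)
    fix f assume f: "f \<in> carrier (pair_algebra A B)"
    then show "\<exists>g \<in> carrier (pair_algebra A B). g \<oplus>\<^bsub>pair_algebra A B\<^esub> f = \<zero>\<^bsub>pair_algebra A B\<^esub>"
      by (intro bexI[of _ "- f"]) (auto simp: pair_algebra_simps in_keys_iff)
  qed (use keys_add in \<open>fastforce simp: pair_algebra_simps algebra_simps\<close>)+
  show "Group.monoid (pair_algebra A B)"
  proof (rule monoidI)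
    fix f g h
    assume "f \<in> carrier (pair_algebra A B)" "g \<in> carrier (pair_algebra A B)"
    then show "f \<otimes>\<^bsub>pair_algebra A B\<^esub> g \<in> carrier (pair_algebra A B)"
      unfolding pair_algebra_simps mem_Collect_eq by (intro keys_pair_conv) auto
    assume "h \<in> carrier (pair_algebra A B)"
    with \<open>f \<in> _\<close> \<open>g \<in> _\<close> show "f \<otimes>\<^bsub>pair_algebra A B\<^esub> g \<otimes>\<^bsub>pair_algebra A B\<^esub> h =
        f \<otimes>\<^bsub>pair_algebra A B\<^esub> (g \<otimes>\<^bsub>pair_algebra A B\<^esub> h)"
      unfolding pair_algebra_simps mem_Collect_eq
      by (intro pair_conv_assoc[of "carrier A \<times> carrier B"]) (auto simp: A.m_assoc B.m_assoc)
  next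
    show "\<one>\<^bsub>pair_algebra A B\<^esub> \<in> carrier (pair_algebra A B)"
      by (simp add: pair_algebra_simps)
  next
    fix f assume f: "f \<in> carrier (pair_algebra A B)"
    show "\<one>\<^bsub>pair_algebra A B\<^esub> \<otimes>\<^bsub>pair_algebra A B\<^esub> f = f"
      using f unfolding pair_algebra_simps mem_Collect_eq
      by (intro pair_conv_unit(1)[of "carrier A \<times> carrier B"]) auto
    show "f \<otimes>\<^bsub>pair_algebra A B\<^esub> \<one>\<^bsub>pair_algebra A B\<^esub> = f"
      using f unfolding pair_algebra_simps mem_Collect_eq
      by (intro pair_conv_unit(2)[of "carrier A \<times> carrier B"]) auto
  qed
qed (simp_all add: pair_algebra_simps pair_conv_add_left pair_conv_add_right)

lemma assoc_algebra_pair_algebra: "assoc_algebra class_ring (pair_algebra A B)"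
proof (rule assoc_algebraI[OF class_field ring_pair_algebra])
  fix c :: 'k and f assume "f \<in> carrier (pair_algebra A B)"
  then show "c \<odot>\<^bsub>pair_algebra A B\<^esub> f \<in> carrier (pair_algebra A B)"
    using keys_scale[of c f] by (auto simp: pair_algebra_simps)
qed (auto simp: pair_algebra_simps scale_add pair_conv_scale lookup_add algebra_simps intro!: poly_mapping_eqI)

interpretation P: assoc_algebra class_ring "pair_algebra A B"
  by (fact assoc_algebra_pair_algebra)

lemma bilinear_relators_subset: "bilinear_relators A B \<subseteq> carrier (pair_algebra A B)"
proof
  fix r assume "r \<in> bilinear_relators A B"
  then have "Poly_Mapping.lookup r p = 0" if "p \<notin> carrier A \<times> carrier B" for p
    using that by (auto simp: bilinear_relators_def lookup_minus lookup_single when_def)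
  then show "r \<in> carrier (pair_algebra A B)"
    by (auto simp: pair_algebra_simps in_keys_iff)
qed

lemma submodule_tensor_relations:
  "LinearCombinations.submodule class_ring (tensor_relations A B) (pair_algebra A B)"
  unfolding tensor_relations_def by (rule P.span_is_submodule[OF bilinear_relators_subset])

lemma bilinear_relators_in_tensor_relations: "bilinear_relators A B \<subseteq> tensor_relations A B"
  unfolding tensor_relations_def by (rule P.in_own_span[OF bilinear_relators_subset])

lemma tensor_relations_closed:
  "0 \<in> tensor_relations A B"
  "f \<in> tensor_relations A B \<Longrightarrow> g \<in> tensor_relations A B \<Longrightarrow> f + g \<in> tensor_relations A B"
  "f \<in> tensor_relations A B \<Longrightarrow> Poly_Mapping.map ((*) c) f \<in> tensor_relations A B"
  "f \<in> tensor_relations A B \<Longrightarrow> f \<in> carrier (pair_algebra A B)"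
  using submodule_tensor_relations
  by (auto simp: LinearCombinations.submodule_def pair_algebra_simps)

lemma tensor_relations_uminus: "f \<in> tensor_relations A B \<Longrightarrow> - f \<in> tensor_relations A B"
proof -
  have "- f = Poly_Mapping.map ((*) (- 1)) f"
    by (rule poly_mapping_eqI) simp
  then show "f \<in> tensor_relations A B \<Longrightarrow> - f \<in> tensor_relations A B"
    using tensor_relations_closed(3)[of f "- 1"] by simp
qed

lemma bilinear_relators_mult_single:
  assumes "r \<in> bilinear_relators A B" "p \<in> carrier A \<times> carrier B"
  shows "r \<otimes>\<^bsub>pair_algebra A B\<^esub> Poly_Mapping.single p d \<in> tensor_relations A B"
    and "Poly_Mapping.single p d \<otimes>\<^bsub>pair_algebra A B\<^esub> r \<in> tensor_relations A B"
proof -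
  obtain x y where p: "p = (x, y)" "x \<in> carrier A" "y \<in> carrier B"
    using assms(2) by auto
  have "\<exists>s \<in> bilinear_relators A B.
      r \<otimes>\<^bsub>pair_algebra A B\<^esub> Poly_Mapping.single p d = Poly_Mapping.map ((*) d) s"
    using assms(1) p(2,3) unfolding bilinear_relators_def bex_Un pair_algebra_simps p(1)
    apply (elim UnE CollectE exE conjE)
    subgoal for a a' b
      by (rule disjI1, rule disjI1, rule disjI1, rule bexI, rule_tac [2] CollectI, rule_tac [2] exI[of _ "a \<otimes>\<^bsub>A\<^esub> x"],
          rule_tac [2] exI[of _ "a' \<otimes>\<^bsub>A\<^esub> x"], rule_tac [2] exI[of _ "b \<otimes>\<^bsub>B\<^esub> y"])
        (auto simp: pair_conv_diff scale_diff scale_single A.l_distr)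
    subgoal for a b b'
      by (rule disjI1, rule disjI1, rule disjI2, rule bexI, rule_tac [2] CollectI, rule_tac [2] exI[of _ "a \<otimes>\<^bsub>A\<^esub> x"],
          rule_tac [2] exI[of _ "b \<otimes>\<^bsub>B\<^esub> y"], rule_tac [2] exI[of _ "b' \<otimes>\<^bsub>B\<^esub> y"])
        (auto simp: pair_conv_diff scale_diff scale_single B.l_distr)
    subgoal for c a b
      by (rule disjI1, rule disjI2, rule bexI, rule_tac [2] CollectI, rule_tac [2] exI[of _ c],
          rule_tac [2] exI[of _ "a \<otimes>\<^bsub>A\<^esub> x"], rule_tac [2] exI[of _ "b \<otimes>\<^bsub>B\<^esub> y"])
        (auto simp: pair_conv_diff scale_diff scale_single A.smult_mult_left mult.commute)
    subgoal for c a b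
      by (rule disjI2, rule bexI, rule_tac [2] CollectI, rule_tac [2] exI[of _ c],
          rule_tac [2] exI[of _ "a \<otimes>\<^bsub>A\<^esub> x"], rule_tac [2] exI[of _ "b \<otimes>\<^bsub>B\<^esub> y"])
        (auto simp: pair_conv_diff scale_diff scale_single B.smult_mult_left mult.commute)
    done
  then show "r \<otimes>\<^bsub>pair_algebra A B\<^esub> Poly_Mapping.single p d \<in> tensor_relations A B"
    using bilinear_relators_in_tensor_relations tensor_relations_closed(3) by auto
  have "\<exists>s \<in> bilinear_relators A B.
      Poly_Mapping.single p d \<otimes>\<^bsub>pair_algebra A B\<^esub> r = Poly_Mapping.map ((*) d) s"
    using assms(1) p(2,3) unfolding bilinear_relators_def bex_Un pair_algebra_simps p(1)
    apply (elim UnE CollectE exE conjE)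
    subgoal for a a' b
      by (rule disjI1, rule disjI1, rule disjI1, rule bexI, rule_tac [2] CollectI, rule_tac [2] exI[of _ "x \<otimes>\<^bsub>A\<^esub> a"],
          rule_tac [2] exI[of _ "x \<otimes>\<^bsub>A\<^esub> a'"], rule_tac [2] exI[of _ "y \<otimes>\<^bsub>B\<^esub> b"])
        (auto simp: pair_conv_diff scale_diff scale_single A.r_distr)
    subgoal for a b b'
      by (rule disjI1, rule disjI1, rule disjI2, rule bexI, rule_tac [2] CollectI, rule_tac [2] exI[of _ "x \<otimes>\<^bsub>A\<^esub> a"],
          rule_tac [2] exI[of _ "y \<otimes>\<^bsub>B\<^esub> b"], rule_tac [2] exI[of _ "y \<otimes>\<^bsub>B\<^esub> b'"])
        (auto simp: pair_conv_diff scale_diff scale_single B.r_distr)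
    subgoal for c a b
      by (rule disjI1, rule disjI2, rule bexI, rule_tac [2] CollectI, rule_tac [2] exI[of _ c],
          rule_tac [2] exI[of _ "x \<otimes>\<^bsub>A\<^esub> a"], rule_tac [2] exI[of _ "y \<otimes>\<^bsub>B\<^esub> b"])
        (auto simp: pair_conv_diff scale_diff scale_single A.smult_mult_right mult.commute)
    subgoal for c a b
      by (rule disjI2, rule bexI, rule_tac [2] CollectI, rule_tac [2] exI[of _ c],
          rule_tac [2] exI[of _ "x \<otimes>\<^bsub>A\<^esub> a"], rule_tac [2] exI[of _ "y \<otimes>\<^bsub>B\<^esub> b"])
        (auto simp: pair_conv_diff scale_diff scale_single B.smult_mult_right mult.commute)
    done
  then show "Poly_Mapping.single p d \<otimes>\<^bsub>pair_algebra A B\<^esub> r \<in> tensor_relations A B"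
    using bilinear_relators_in_tensor_relations tensor_relations_closed(3) by auto
qed

lemma tensor_relations_mult:
  assumes "f \<in> tensor_relations A B" "g \<in> carrier (pair_algebra A B)"
  shows "f \<otimes>\<^bsub>pair_algebra A B\<^esub> g \<in> tensor_relations A B"
    and "g \<otimes>\<^bsub>pair_algebra A B\<^esub> f \<in> tensor_relations A B"
proof -
  let ?N = "{f \<in> carrier (pair_algebra A B). f \<otimes>\<^bsub>pair_algebra A B\<^esub> g \<in> tensor_relations A B \<and>
    g \<otimes>\<^bsub>pair_algebra A B\<^esub> f \<in> tensor_relations A B}"
  have g: "Poly_Mapping.keys g \<subseteq> carrier A \<times> carrier B"
    using assms(2) by (simp add: pair_algebra_simps)
  have "bilinear_relators A B \<subseteq> ?N"
  proof
    fix r assume r: "r \<in> bilinear_relators A B"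
    have "r \<otimes>\<^bsub>pair_algebra A B\<^esub> g \<in> tensor_relations A B \<and>
      g \<otimes>\<^bsub>pair_algebra A B\<^esub> r \<in> tensor_relations A B"
      using g
    proof (induction g rule: finsupp_induct)
      case zero
      show ?case by (simp add: pair_algebra_simps tensor_relations_closed)
    next
      case (single p c)
      with r show ?case by (simp add: bilinear_relators_mult_single)
    next
      case (add f g)
      then show ?case
        by (simp add: pair_algebra_simps pair_conv_add_left pair_conv_add_right tensor_relations_closed)
    qed
    with r show "r \<in> ?N"
      using bilinear_relators_subset by auto
  qed
  moreover have "LinearCombinations.submodule class_ring ?N (pair_algebra A B)"
  proof (rule LinearCombinations.submodule.intro)
    fix v w assume v: "v \<in> ?N" and w: "w \<in> ?N"
    have "v \<oplus>\<^bsub>pair_algebra A B\<^esub> w \<in> carrier (pair_algebra A B)"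
      using v w by simp
    with v w show "v \<oplus>\<^bsub>pair_algebra A B\<^esub> w \<in> ?N"
      by (simp add: pair_algebra_simps pair_conv_add_left pair_conv_add_right tensor_relations_closed)
  next
    fix c :: 'k and v assume v: "v \<in> ?N"
    have "c \<odot>\<^bsub>pair_algebra A B\<^esub> v \<in> carrier (pair_algebra A B)"
      using v by simp
    with v show "c \<odot>\<^bsub>pair_algebra A B\<^esub> v \<in> ?N"
      by (simp add: pair_algebra_simps pair_conv_scale tensor_relations_closed)
  qed (use P.module_axioms in \<open>auto simp: pair_algebra_simps tensor_relations_closed\<close>)
  ultimately have "tensor_relations A B \<subseteq> ?N"
    unfolding tensor_relations_def[of A B] by (rule P.span_is_subset)
  with assms show "f \<otimes>\<^bsub>pair_algebra A B\<^esub> g \<in> tensor_relations A B"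
    and "g \<otimes>\<^bsub>pair_algebra A B\<^esub> f \<in> tensor_relations A B" by auto
qed

lemma ideal_tensor_relations: "ideal (tensor_relations A B) (pair_algebra A B)"
proof (rule idealI[OF ring_pair_algebra])
  show "subgroup (tensor_relations A B) (add_monoid (pair_algebra A B))"
  proof (rule P.add.subgroupI)
    fix f assume f: "f \<in> tensor_relations A B"
    have "\<ominus>\<^bsub>pair_algebra A B\<^esub> f = - f"
      by (rule P.minus_equality)
        (use f tensor_relations_uminus[OF f] in
          \<open>auto simp: tensor_relations_closed(4) pair_algebra_simps(4,5)\<close>)
    with f show "\<ominus>\<^bsub>pair_algebra A B\<^esub> f \<in> tensor_relations A B"
      by (simp add: tensor_relations_uminus)
  next
    show "f \<oplus>\<^bsub>pair_algebra A B\<^esub> g \<in> tensor_relations A B"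
      if "f \<in> tensor_relations A B" "g \<in> tensor_relations A B" for f g
      using that by (simp add: pair_algebra_simps tensor_relations_closed)
  qed (use tensor_relations_closed(1,4) in auto)
qed (simp_all add: tensor_relations_mult)

interpretation I: ideal "tensor_relations A B" "pair_algebra A B"
  by (fact ideal_tensor_relations)

lemma tensor_product_simps:
  "carrier (tensor_product A B) =
     (\<lambda>f. tensor_relations A B +>\<^bsub>pair_algebra A B\<^esub> f) ` carrier (pair_algebra A B)"
  "mult (tensor_product A B) = rcoset_mult (pair_algebra A B) (tensor_relations A B)"
  "one (tensor_product A B) = tensor_relations A B +>\<^bsub>pair_algebra A B\<^esub> \<one>\<^bsub>pair_algebra A B\<^esub>"
  "zero (tensor_product A B) = tensor_relations A B"
  "add (tensor_product A B) = set_add (pair_algebra A B)"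
  by (auto simp: tensor_product_def FactRing_def ring.defs module.defs A_RCOSETS_def' )

lemma tensor_product_mult:
  assumes "f \<in> carrier (pair_algebra A B)" "g \<in> carrier (pair_algebra A B)"
  shows "(tensor_relations A B +>\<^bsub>pair_algebra A B\<^esub> f) \<otimes>\<^bsub>tensor_product A B\<^esub>
      (tensor_relations A B +>\<^bsub>pair_algebra A B\<^esub> g) =
    tensor_relations A B +>\<^bsub>pair_algebra A B\<^esub> (f \<otimes>\<^bsub>pair_algebra A B\<^esub> g)"
  using assms by (simp add: tensor_product_simps I.rcoset_mult_add)

lemma tensor_product_add:
  assumes "f \<in> carrier (pair_algebra A B)" "g \<in> carrier (pair_algebra A B)"
  shows "(tensor_relations A B +>\<^bsub>pair_algebra A B\<^esub> f) \<oplus>\<^bsub>tensor_product A B\<^esub>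
      (tensor_relations A B +>\<^bsub>pair_algebra A B\<^esub> g) =
    tensor_relations A B +>\<^bsub>pair_algebra A B\<^esub> (f \<oplus>\<^bsub>pair_algebra A B\<^esub> g)"
  using assms by (simp add: tensor_product_simps I.a_rcos_sum)

lemma tensor_product_smult:
  assumes f: "f \<in> carrier (pair_algebra A B)"
  shows "c \<odot>\<^bsub>tensor_product A B\<^esub> (tensor_relations A B +>\<^bsub>pair_algebra A B\<^esub> f) =
    tensor_relations A B +>\<^bsub>pair_algebra A B\<^esub> (c \<odot>\<^bsub>pair_algebra A B\<^esub> f)"
    (is "_ = ?X")
proof -
  have const: "tensor_relations A B +>\<^bsub>pair_algebra A B\<^esub> (c \<odot>\<^bsub>pair_algebra A B\<^esub> g) = ?X"
    if g: "g \<in> tensor_relations A B +>\<^bsub>pair_algebra A B\<^esub> f" for g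
  proof -
    obtain i where i: "i \<in> tensor_relations A B" "g = i \<oplus>\<^bsub>pair_algebra A B\<^esub> f"
      using g by (auto simp: a_r_coset_def')
    then have "c \<odot>\<^bsub>pair_algebra A B\<^esub> g \<in> ?X"
      using f tensor_relations_closed(3)[of i c]
      by (auto simp: a_r_coset_def' pair_algebra_simps scale_add)
    then show ?thesis
      using f by (intro I.a_repr_independence'[symmetric]) auto
  qed
  have "(\<Union>g \<in> tensor_relations A B +>\<^bsub>pair_algebra A B\<^esub> f.
      tensor_relations A B +>\<^bsub>pair_algebra A B\<^esub> (c \<odot>\<^bsub>pair_algebra A B\<^esub> g)) = ?X"
    by (rule UN_constant_eq[OF I.a_rcos_self[OF f]]) (rule ballI, rule const)
  then show ?thesis
    by (simp only: tensor_product_def FactRing_def ring.defs module.defs module.simps)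
qed

lemma ring_tensor_product: "ring (tensor_product A B)"
proof -
  interpret Q: ring "pair_algebra A B Quot tensor_relations A B"
    by (rule I.quotient_is_ring)
  have eqs:
    "carrier (tensor_product A B) = carrier (pair_algebra A B Quot tensor_relations A B)"
    "mult (tensor_product A B) = mult (pair_algebra A B Quot tensor_relations A B)"
    "one (tensor_product A B) = one (pair_algebra A B Quot tensor_relations A B)"
    "zero (tensor_product A B) = zero (pair_algebra A B Quot tensor_relations A B)"
    "add (tensor_product A B) = add (pair_algebra A B Quot tensor_relations A B)"
    by (simp_all add: tensor_product_def ring.defs)
  show ?thesis
  proof (rule ringI)
    show "abelian_group (tensor_product A B)"
      by (rule abelian_groupI) (use Q.a_assoc Q.a_comm Q.l_neg in \<open>auto simp: eqs\<close>)
    show "Group.monoid (tensor_product A B)"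
      by (rule monoidI) (auto simp: eqs Q.m_assoc)
  qed (auto simp: eqs Q.l_distr Q.r_distr)
qed

theorem assoc_algebra_tensor_product: "assoc_algebra class_ring (tensor_product A B)"
proof (rule assoc_algebraI[OF class_field ring_tensor_product])
  fix c d :: 'k and X Y
  assume "X \<in> carrier (tensor_product A B)" "Y \<in> carrier (tensor_product A B)"
  then obtain f g where f: "f \<in> carrier (pair_algebra A B)"
      and X: "X = tensor_relations A B +>\<^bsub>pair_algebra A B\<^esub> f"
      and g: "g \<in> carrier (pair_algebra A B)"
      and Y: "Y = tensor_relations A B +>\<^bsub>pair_algebra A B\<^esub> g"
    by (auto simp: tensor_product_simps(1))
  note simps = f g X Y tensor_product_add tensor_product_mult tensor_product_smult
  show "c \<odot>\<^bsub>tensor_product A B\<^esub> X \<in> carrier (tensor_product A B)"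
    using P.smult_closed[of c f] f by (simp add: X tensor_product_smult tensor_product_simps(1))
  show "(c \<oplus>\<^bsub>class_ring\<^esub> d) \<odot>\<^bsub>tensor_product A B\<^esub> X =
      c \<odot>\<^bsub>tensor_product A B\<^esub> X \<oplus>\<^bsub>tensor_product A B\<^esub> d \<odot>\<^bsub>tensor_product A B\<^esub> X"
    using P.smult_l_distr[of c d f] by (simp add: simps)
  show "c \<odot>\<^bsub>tensor_product A B\<^esub> (X \<oplus>\<^bsub>tensor_product A B\<^esub> Y) =
      c \<odot>\<^bsub>tensor_product A B\<^esub> X \<oplus>\<^bsub>tensor_product A B\<^esub> c \<odot>\<^bsub>tensor_product A B\<^esub> Y"
    using P.smult_r_distr[of c f g] by (simp add: simps)
  show "(c \<otimes>\<^bsub>class_ring\<^esub> d) \<odot>\<^bsub>tensor_product A B\<^esub> X =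
      c \<odot>\<^bsub>tensor_product A B\<^esub> (d \<odot>\<^bsub>tensor_product A B\<^esub> X)"
    using P.smult_assoc1[of c d f] by (simp add: simps)
  show "\<one>\<^bsub>class_ring\<^esub> \<odot>\<^bsub>tensor_product A B\<^esub> X = X"
    using P.smult_one[of f] by (simp add: simps)
  show "(c \<odot>\<^bsub>tensor_product A B\<^esub> X) \<otimes>\<^bsub>tensor_product A B\<^esub> Y =
      c \<odot>\<^bsub>tensor_product A B\<^esub> (X \<otimes>\<^bsub>tensor_product A B\<^esub> Y)"
    using P.smult_mult_left[of c f g] by (simp add: simps)
  show "X \<otimes>\<^bsub>tensor_product A B\<^esub> (c \<odot>\<^bsub>tensor_product A B\<^esub> Y) =
      c \<odot>\<^bsub>tensor_product A B\<^esub> (X \<otimes>\<^bsub>tensor_product A B\<^esub> Y)"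
    using P.smult_mult_right[of c f g] by (simp add: simps)
qed

lemma tensor_closed:
  "a \<in> carrier A \<Longrightarrow> b \<in> carrier B \<Longrightarrow> tensor A B a b \<in> carrier (tensor_product A B)"
  unfolding tensor_def tensor_product_simps(1)
  by (rule imageI) (simp add: pair_algebra_simps)

lemma tensor_mult:
  assumes "a \<in> carrier A" "b \<in> carrier B" "a' \<in> carrier A" "b' \<in> carrier B"
  shows "tensor A B a b \<otimes>\<^bsub>tensor_product A B\<^esub> tensor A B a' b' =
    tensor A B (a \<otimes>\<^bsub>A\<^esub> a') (b \<otimes>\<^bsub>B\<^esub> b')"
  using assms unfolding tensor_def
  by (subst tensor_product_mult) (auto simp: pair_algebra_simps)

lemma tensor_one: "tensor A B \<one>\<^bsub>A\<^esub> \<one>\<^bsub>B\<^esub> = \<one>\<^bsub>tensor_product A B\<^esub>"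
  by (simp add: tensor_def tensor_product_simps(3) pair_algebra_simps(3))

lemma coset_eqI:
  assumes "f \<in> carrier (pair_algebra A B)" "g \<in> carrier (pair_algebra A B)" "f - g \<in> tensor_relations A B"
  shows "tensor_relations A B +>\<^bsub>pair_algebra A B\<^esub> f = tensor_relations A B +>\<^bsub>pair_algebra A B\<^esub> g"
proof (rule I.a_repr_independence'[symmetric])
  show "f \<in> tensor_relations A B +>\<^bsub>pair_algebra A B\<^esub> g"
    using assms(3) by (auto simp: a_r_coset_def' pair_algebra_simps intro!: bexI[of _ "f - g"])
qed (use assms in auto)

lemma tensor_add_left:
  assumes "a \<in> carrier A" "a' \<in> carrier A" "b \<in> carrier B"
  shows "tensor A B (a \<oplus>\<^bsub>A\<^esub> a') b = tensor A B a b \<oplus>\<^bsub>tensor_product A B\<^esub> tensor A B a' b"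
proof -
  have "Poly_Mapping.single (a \<oplus>\<^bsub>A\<^esub> a', b) 1 - (Poly_Mapping.single (a, b) 1 + Poly_Mapping.single (a', b) 1)
      \<in> tensor_relations A B"
    using assms by (intro subsetD[OF bilinear_relators_in_tensor_relations])
      (auto simp: bilinear_relators_def diff_diff_eq)
  moreover have "Poly_Mapping.keys (Poly_Mapping.single (a, b) (1::'k) + Poly_Mapping.single (a', b) 1)
      \<subseteq> carrier A \<times> carrier B"
    by (rule order.trans[OF keys_add]) (use assms in simp)
  ultimately show ?thesis
    unfolding tensor_def
    by (subst tensor_product_add) (use assms in \<open>simp_all add: pair_algebra_simps coset_eqI\<close>)
qed

lemma tensor_add_right:
  assumes "a \<in> carrier A" "b \<in> carrier B" "b' \<in> carrier B"
  shows "tensor A B a (b \<oplus>\<^bsub>B\<^esub> b') = tensor A B a b \<oplus>\<^bsub>tensor_product A B\<^esub> tensor A B a b'"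
proof -
  have "Poly_Mapping.single (a, b \<oplus>\<^bsub>B\<^esub> b') 1 - (Poly_Mapping.single (a, b) 1 + Poly_Mapping.single (a, b') 1)
      \<in> tensor_relations A B"
    using assms by (intro subsetD[OF bilinear_relators_in_tensor_relations])
      (auto simp: bilinear_relators_def diff_diff_eq)
  moreover have "Poly_Mapping.keys (Poly_Mapping.single (a, b) (1::'k) + Poly_Mapping.single (a, b') 1)
      \<subseteq> carrier A \<times> carrier B"
    by (rule order.trans[OF keys_add]) (use assms in simp)
  ultimately show ?thesis
    unfolding tensor_def
    by (subst tensor_product_add) (use assms in \<open>simp_all add: pair_algebra_simps coset_eqI\<close>)
qed

lemma tensor_smult:
  assumes "a \<in> carrier A" "b \<in> carrier B"
  shows "tensor A B (c \<odot>\<^bsub>A\<^esub> a) b = c \<odot>\<^bsub>tensor_product A B\<^esub> tensor A B a b"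
    and "tensor A B a (c \<odot>\<^bsub>B\<^esub> b) = c \<odot>\<^bsub>tensor_product A B\<^esub> tensor A B a b"
proof -
  have 1: "Poly_Mapping.single (c \<odot>\<^bsub>A\<^esub> a, b) 1 - Poly_Mapping.single (a, b) c \<in> tensor_relations A B"
    using assms by (intro subsetD[OF bilinear_relators_in_tensor_relations])
      (auto simp: bilinear_relators_def)
  have 2: "Poly_Mapping.single (a, c \<odot>\<^bsub>B\<^esub> b) 1 - Poly_Mapping.single (a, b) c \<in> tensor_relations A B"
    using assms by (intro subsetD[OF bilinear_relators_in_tensor_relations])
      (auto simp: bilinear_relators_def)
  show "tensor A B (c \<odot>\<^bsub>A\<^esub> a) b = c \<odot>\<^bsub>tensor_product A B\<^esub> tensor A B a b"
    "tensor A B a (c \<odot>\<^bsub>B\<^esub> b) = c \<odot>\<^bsub>tensor_product A B\<^esub> tensor A B a b"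
    using assms 1 2 unfolding tensor_def
    by (simp_all add: tensor_product_smult pair_algebra_simps scale_single coset_eqI)
qed

end

section \<open>Endomorphisms as matrices\<close>

text \<open>
  An ordered basis \<open>bs\<close> of \<open>V\<close> identifies \<open>End\<^sub>K(V)\<close> with the matrix algebra: column \<open>j\<close> of the
  matrix of \<open>f\<close> holds the coordinates of \<open>f (bs ! j)\<close>.
\<close>

definition ordered_basis :: "'k ring \<Rightarrow> ('k, 'a) module \<Rightarrow> 'a list \<Rightarrow> bool" where
  "ordered_basis K V bs \<longleftrightarrow> distinct bs \<and> vectorspace.basis K V (set bs)"

definition coordinates :: "'k ring \<Rightarrow> ('k, 'a) module \<Rightarrow> 'a list \<Rightarrow> 'a \<Rightarrow> 'a \<Rightarrow> 'k" where
  "coordinates K V bs v =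
     (THE c. c \<in> set bs \<rightarrow>\<^sub>E carrier K \<and> LinearCombinations.module.lincomb V c (set bs) = v)"

definition matrix_of_end :: "'k ring \<Rightarrow> ('k, 'a) module \<Rightarrow> 'a list \<Rightarrow> ('a \<Rightarrow> 'a) \<Rightarrow> 'k mat" where
  "matrix_of_end K V bs f =
     mat (length bs) (length bs) (\<lambda>(i, j). coordinates K V bs (f (bs ! j)) (bs ! i))"

lemma coordinates:
  assumes "vectorspace K V" "ordered_basis K V bs" "v \<in> carrier V"
  shows "coordinates K V bs v \<in> set bs \<rightarrow>\<^sub>E carrier K"
    and "LinearCombinations.module.lincomb V (coordinates K V bs v) (set bs) = v"
proof -
  interpret vectorspace K V by fact
  have "\<exists>!c. c \<in> set bs \<rightarrow>\<^sub>E carrier K \<and> lincomb c (set bs) = v"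
    using assms(2,3) basis_criterion[of "set bs"] unfolding ordered_basis_def basis_def by blast
  from theI'[OF this]
  show "coordinates K V bs v \<in> set bs \<rightarrow>\<^sub>E carrier K"
    and "lincomb (coordinates K V bs v) (set bs) = v"
    unfolding coordinates_def by auto
qed

definition left_regular :: "('a, 'm) ring_scheme \<Rightarrow> 'a \<Rightarrow> 'a \<Rightarrow> 'a" where
  "left_regular R a = (\<lambda>x. a \<otimes>\<^bsub>R\<^esub> x)"

definition right_regular :: "('a, 'm) ring_scheme \<Rightarrow> 'a \<Rightarrow> 'a \<Rightarrow> 'a" where
  "right_regular R a = (\<lambda>x. x \<otimes>\<^bsub>R\<^esub> a)"

end

theory Submission
  imports Defs "Jordan_Normal_Form.DL_Rank"
begin

text \<open>
  The space \<open>K\<^sup>N\<close>, \<open>N = n\<^sup>2\<close>, is an \<open>A\<^sub>1\<close>-module via \<open>\<phi>\<^sub>1\<close> of the same dimension as the regular module. Over a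
  simple algebra such a module has a vector \<open>v\<close> with \<open>a \<mapsto> \<phi>\<^sub>1(a) v\<close> bijective: choose \<open>v\<close> with annihilator of
  least dimension; if the annihilator were nonzero, it would contain an idempotent \<open>e\<close> generating a minimal
  left ideal, and \<open>v + e w\<close> would have a smaller annihilator for a suitable \<open>w\<close>. This isomorphism with the
  regular module gives \<open>X\<close>. The images of \<open>\<phi>\<^sub>1\<close> and \<open>\<phi>\<^sub>2\<close> commute, so \<open>\<phi>\<^sub>2'(A\<^sub>2)\<close> lies in the centralizer
  of \<open>\<lambda>(A\<^sub>1)\<close>, which is \<open>\<rho>(A\<^sub>1)\<close>; since \<open>\<phi>\<^sub>2'\<close> is injective by simplicity of \<open>A\<^sub>2\<close>, comparing dimensions
  gives \<open>\<phi>\<^sub>2'(A\<^sub>2) = \<rho>(A\<^sub>1)\<close>. A composite of an anti-isomorphism with the inverse of another one is an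
  isomorphism.
\<close>

subsection \<open>Dimensions of subspaces\<close>

lemma (in vectorspace) subspaceI:
  assumes "W \<subseteq> carrier V" "\<zero>\<^bsub>V\<^esub> \<in> W"
    and "\<And>v w. v \<in> W \<Longrightarrow> w \<in> W \<Longrightarrow> v \<oplus>\<^bsub>V\<^esub> w \<in> W"
    and "\<And>c v. c \<in> carrier K \<Longrightarrow> v \<in> W \<Longrightarrow> c \<odot>\<^bsub>V\<^esub> v \<in> W"
  shows "VectorSpace.subspace K W V"
  using assms vectorspace_axioms module.module_axioms
  by (auto simp: VectorSpace.subspace_def submodule_def)

text \<open>Independence in \<open>vs W\<close> agrees with independence in \<open>V\<close>, so
  independent subsets of \<open>W\<close> have at most \<open>dim\<close> elements. Hence a maximal
  one exists, and it is a basis of \<open>W\<close>.\<close>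

lemma (in vectorspace) finite_basis_subspace:
  assumes "fin_dim" and W: "VectorSpace.subspace K W V"
  obtains B where "finite B" "B \<subseteq> W" "lin_indpt B" "vectorspace.basis K (vs W) B"
proof -
  have sub: "submodule K W V" and WV: "W \<subseteq> carrier V"
    using W by (auto simp: VectorSpace.subspace_def submodule_def)
  interpret W: vectorspace K "vs W"
    using W by (rule subspace_is_vs)
  have li: "W.lin_dep B = lin_dep B" if "B \<subseteq> W" for B
    using span_li_not_depend(2)[OF that sub] .
  have "\<exists>B. finite B \<and> maximal B (\<lambda>S. S \<subseteq> carrier (vs W) \<and> W.lin_indpt S)"
  proof (rule maximal_exists[where B = "{}"])
    show "finite A \<and> card A \<le> dim" if "A \<subseteq> carrier (vs W) \<and> W.lin_indpt A" for A
      using that li[of A] WV li_le_dim[OF \<open>fin_dim\<close>, of A] by auto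
  qed (auto simp: W.lin_dep_def)
  then obtain B where B: "finite B" "maximal B (\<lambda>S. S \<subseteq> carrier (vs W) \<and> W.lin_indpt S)"
    by blast
  then have "W.basis B" by (intro W.max_li_is_basis)
  with B show thesis
    by (intro that[of B]) (auto simp: maximal_def li)
qed

lemma (in vectorspace) fin_dim_subspace:
  assumes "fin_dim" "VectorSpace.subspace K W V"
  shows "vectorspace.fin_dim K (vs W)"
proof -
  interpret W: vectorspace K "vs W"
    using assms(2) by (rule subspace_is_vs)
  show ?thesis
    using finite_basis_subspace[OF assms] unfolding W.fin_dim_def W.basis_def by metis
qed

text \<open>Otherwise a basis of \<open>W\<close> would have at least \<open>dim\<close> independent
  elements, hence be a basis of \<open>V\<close> and span it.\<close>

lemma (in vectorspace) dim_subspace_less: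
  assumes "fin_dim" "VectorSpace.subspace K W V" "W \<noteq> carrier V"
  shows "vectorspace.dim K (vs W) < dim"
proof (rule ccontr)
  assume not_less: "\<not> vectorspace.dim K (vs W) < dim"
  interpret W: vectorspace K "vs W"
    using assms(2) by (rule subspace_is_vs)
  have WV: "W \<subseteq> carrier V" and sub: "submodule K W V"
    using assms(2) by (auto simp: VectorSpace.subspace_def submodule_def)
  obtain B where B: "finite B" "B \<subseteq> W" "lin_indpt B" "W.basis B"
    using finite_basis_subspace[OF assms(1,2)] .
  have "card B \<ge> dim"
    using W.dim_basis B not_less by auto
  then have "basis B"
    using dim_li_is_basis[OF assms(1)] B WV by auto
  then have "carrier V \<subseteq> W"
    using span_is_subset[OF B(2) sub] by (auto simp: basis_def)
  with WV assms(3) show False by auto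
qed

text \<open>The preceding bound inside \<open>vs W\<close>. It drives both minimality arguments
  below, over left ideals and over annihilators.\<close>

lemma (in vectorspace) dim_subspace_strict_mono:
  assumes "fin_dim" "VectorSpace.subspace K W V" "VectorSpace.subspace K U V" "U \<subset> W"
  shows "vectorspace.dim K (vs U) < vectorspace.dim K (vs W)"
proof -
  interpret W: vectorspace K "vs W"
    using assms(2) by (rule subspace_is_vs)
  show ?thesis
    using W.dim_subspace_less[OF fin_dim_subspace[OF assms(1,2)] nested_subspaces[OF assms(2,3)]] assms(4)
    by auto
qed

text \<open>By rank-nullity a zero kernel gives the image full dimension, which a proper subspace
  cannot have.\<close>

lemma (in linear_map) inj_imp_surj:
  assumes "V.fin_dim" "W.fin_dim" "V.dim = W.dim" "inj_on T (carrier V)"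
  shows "T ` carrier V = carrier W"
proof (rule ccontr)
  assume "T ` carrier V \<noteq> carrier W"
  then have "vectorspace.dim K (W.vs imT) < W.dim"
    using W.dim_subspace_less[OF assms(2) imT_is_subspace] by (simp add: im_def)
  then show False
    using rank_nullity[OF assms(1)] inj_imp_dim_ker0[OF assms(4)] assms(3) by simp
qed

lemma (in linear_map) surj_imp_inj:
  assumes "V.fin_dim" "V.dim = W.dim" "T ` carrier V = carrier W"
  shows "inj_on T (carrier V)"
proof (rule Ke0_imp_inj, rule ccontr)
  assume ker: "carrier (V.vs kerT) \<noteq> {\<zero>\<^bsub>V\<^esub>}"
  have "VectorSpace.subspace K {\<zero>\<^bsub>V\<^esub>} V"
    by (rule V.subspaceI) auto
  moreover have "{\<zero>\<^bsub>V\<^esub>} \<subset> kerT"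
    using ker by (auto simp: ker_def)
  ultimately have "vectorspace.dim K (V.vs kerT) > 0"
    using V.dim_subspace_strict_mono[OF assms(1) kerT_is_subspace] by fastforce
  then show False
    using rank_nullity[OF assms(1)] assms(2,3) by (simp add: im_def)
qed

lemma linear_mapI:
  assumes "vectorspace K V" "vectorspace K W"
    and "\<And>v. v \<in> carrier V \<Longrightarrow> T v \<in> carrier W"
    and "\<And>v w. v \<in> carrier V \<Longrightarrow> w \<in> carrier V \<Longrightarrow> T (v \<oplus>\<^bsub>V\<^esub> w) = T v \<oplus>\<^bsub>W\<^esub> T w"
    and "\<And>c v. c \<in> carrier K \<Longrightarrow> v \<in> carrier V \<Longrightarrow> T (c \<odot>\<^bsub>V\<^esub> v) = c \<odot>\<^bsub>W\<^esub> T v"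
  shows "linear_map K V W T"
  using assms unfolding linear_map_def mod_hom_def mod_hom_axioms_def
    LinearCombinations.module_hom_def vectorspace_def
  by auto

text \<open>The set where \<open>T\<close> and \<open>U\<close> agree is a subspace containing the
  basis.\<close>

lemma linear_map_eq_on_basis:
  assumes "linear_map K V W T" "linear_map K V W U" "vectorspace.basis K V B"
    and eq: "\<And>b. b \<in> B \<Longrightarrow> T b = U b" and x: "x \<in> carrier V"
  shows "T x = U x"
proof -
  interpret V: vectorspace K V using assms(1) by (simp add: linear_map_def)
  interpret T: linear_map K V W T by fact
  interpret U: linear_map K V W U by fact
  have "VectorSpace.subspace K {v \<in> carrier V. T v = U v} V"
    by (rule V.subspaceI) auto
  then have "V.span B \<subseteq> {v \<in> carrier V. T v = U v}"
    using assms(3) eq by (intro V.span_is_subset) (auto simp: V.basis_def VectorSpace.subspace_def)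
  with x assms(3) show ?thesis by (auto simp: V.basis_def)
qed

subsection \<open>Cyclic modules over simple algebras\<close>

text \<open>Phrased through \<open>subspace\<close> so that left ideals have dimensions to
  minimise.\<close>

definition left_ideal :: "'k ring \<Rightarrow> ('k, 'a) module \<Rightarrow> 'a set \<Rightarrow> bool" where
  "left_ideal K A J \<longleftrightarrow>
     VectorSpace.subspace K J A \<and> (\<forall>a \<in> carrier A. \<forall>x \<in> J. a \<otimes>\<^bsub>A\<^esub> x \<in> J)"

definition simple_algebra :: "'k ring \<Rightarrow> ('k, 'a) module \<Rightarrow> bool" where
  "simple_algebra K A \<longleftrightarrow>
     assoc_algebra K A \<and> carrier A \<noteq> {\<zero>\<^bsub>A\<^esub>} \<and>
     (\<forall>I. ideal I A \<longrightarrow> I = {\<zero>\<^bsub>A\<^esub>} \<or> I = carrier A)"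

context assoc_algebra
begin

lemma left_idealD:
  assumes "left_ideal K A J"
  shows "VectorSpace.subspace K J A" "J \<subseteq> carrier A" "\<zero> \<in> J"
    "\<And>x y. x \<in> J \<Longrightarrow> y \<in> J \<Longrightarrow> x \<oplus> y \<in> J"
    "\<And>c x. c \<in> carrier K \<Longrightarrow> x \<in> J \<Longrightarrow> c \<odot> x \<in> J"
    "\<And>a x. a \<in> carrier A \<Longrightarrow> x \<in> J \<Longrightarrow> a \<otimes> x \<in> J"
  using assms by (auto simp: left_ideal_def VectorSpace.subspace_def submodule_def)

lemma left_idealI:
  assumes "J \<subseteq> carrier A" "\<zero> \<in> J"
    and "\<And>x y. x \<in> J \<Longrightarrow> y \<in> J \<Longrightarrow> x \<oplus> y \<in> J"
    and "\<And>c x. c \<in> carrier K \<Longrightarrow> x \<in> J \<Longrightarrow> c \<odot> x \<in> J"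
    and "\<And>a x. a \<in> carrier A \<Longrightarrow> x \<in> J \<Longrightarrow> a \<otimes> x \<in> J"
  shows "left_ideal K A J"
  unfolding left_ideal_def using assms by (auto intro!: subspaceI)

text \<open>Additive inverses come from left multiplication by
  \<open>\<ominus> \<one>\<close>.\<close>

lemma ideal_of_closed:
  assumes "J \<subseteq> carrier A" "\<zero> \<in> J"
    and add: "\<And>x y. x \<in> J \<Longrightarrow> y \<in> J \<Longrightarrow> x \<oplus> y \<in> J"
    and left: "\<And>a x. a \<in> carrier A \<Longrightarrow> x \<in> J \<Longrightarrow> a \<otimes> x \<in> J"
    and right: "\<And>a x. a \<in> carrier A \<Longrightarrow> x \<in> J \<Longrightarrow> x \<otimes> a \<in> J"
  shows "ideal J A"
proof (rule idealI[OF A.ring_axioms])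
  show "subgroup J (add_monoid A)"
  proof (rule A.add.subgroupI)
    fix x assume x: "x \<in> J"
    then have "\<ominus> x = (\<ominus> \<one>) \<otimes> x"
      using assms(1) by (metis A.l_minus A.l_one A.one_closed subsetD)
    with x show "\<ominus> x \<in> J" by (simp add: left)
  qed (use assms in auto)
qed (use left right in auto)

text \<open>Brauer's lemma: a minimal left ideal of nonzero square is generated by an idempotent.\<close>

lemma simple_idempotent:
  assumes simple: "simple_algebra K A" and fd: "fin_dim"
    and I: "left_ideal K A I" "I \<noteq> {\<zero>}"
  obtains e where "e \<in> I" "e \<noteq> \<zero>" "e \<otimes> e = e"
    "\<And>a. a \<in> carrier A \<Longrightarrow> a \<otimes> e \<noteq> \<zero> \<Longrightarrow> \<exists>b \<in> carrier A. b \<otimes> (a \<otimes> e) = e"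
proof -
  \<comment> \<open>A nonzero left ideal inside \<open>I\<close> of least dimension is a minimal
    left ideal; this is where finite dimension enters.\<close>
  define P where "P = (\<lambda>J. left_ideal K A J \<and> J \<noteq> {\<zero>} \<and> J \<subseteq> I)"
  obtain S where S: "P S"
    and least: "\<And>J. P J \<Longrightarrow> vectorspace.dim K (vs S) \<le> vectorspace.dim K (vs J)"
    using ex_has_least_nat[of P I "\<lambda>J. vectorspace.dim K (vs J)"] I by (auto simp: P_def)
  have SL: "left_ideal K A S" and S0: "S \<noteq> {\<zero>}" and SI: "S \<subseteq> I"
    using S by (auto simp: P_def)
  note Sd = left_idealD[OF SL]
  have min: "J = S" if J: "left_ideal K A J" "J \<noteq> {\<zero>}" "J \<subseteq> S" for J
  proof (rule ccontr)
    assume "J \<noteq> S"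
    then have "vectorspace.dim K (vs J) < vectorspace.dim K (vs S)"
      using dim_subspace_strict_mono[OF fd Sd(1) left_idealD(1)[OF J(1)]] J(3) by auto
    moreover have "P J" using J SI by (auto simp: P_def)
    ultimately show False using least by fastforce
  qed
  \<comment> \<open>If \<open>S\<close> had square zero, its left annihilator \<open>?N\<close>
    would be a two-sided ideal containing \<open>S\<close>. By simplicity \<open>?N\<close> is
    everything, so \<open>\<one>\<close> kills \<open>S\<close>, contradicting
    \<open>S \<noteq> {\<zero>}\<close>.\<close>
  have "\<exists>s \<in> S. \<exists>t \<in> S. s \<otimes> t \<noteq> \<zero>"
  proof (rule ccontr)
    assume zero: "\<not> (\<exists>s \<in> S. \<exists>t \<in> S. s \<otimes> t \<noteq> \<zero>)"
    let ?N = "{x \<in> carrier A. \<forall>t \<in> S. x \<otimes> t = \<zero>}"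
    have "ideal ?N A"
      by (rule ideal_of_closed) (use Sd in \<open>auto simp: subset_iff A.l_distr A.m_assoc\<close>)
    moreover have "S \<subseteq> ?N" using zero Sd(2) by auto
    ultimately have "?N = carrier A"
      using simple S0 Sd(3) unfolding simple_algebra_def by blast
    then have "\<one> \<in> ?N" by simp
    then have "\<one> \<otimes> t = \<zero>" if "t \<in> S" for t
      using that by blast
    then have "t = \<zero>" if "t \<in> S" for t
      using that subsetD[OF Sd(2) that] A.l_one[of t] by metis
    then show False using S0 Sd(3) by blast
  qed
  then obtain s t where st: "s \<in> S" "t \<in> S" "s \<otimes> t \<noteq> \<zero>" by blast
  have sA: "s \<in> carrier A" and tA: "t \<in> carrier A" using st Sd(2) by auto
  \<comment> \<open>The left ideal \<open>S t\<close> lies in \<open>S\<close> and contains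
    \<open>s \<otimes> t \<noteq> \<zero>\<close>, so it is \<open>S\<close> by minimality. As
    \<open>t\<close> lies in it, some \<open>e\<close> in \<open>S\<close> satisfies
    \<open>e \<otimes> t = t\<close>.\<close>
  have "(\<lambda>x. x \<otimes> t) ` S = S"
  proof (rule min)
    show "left_ideal K A ((\<lambda>x. x \<otimes> t) ` S)"
    proof (rule left_idealI)
      show "\<zero> \<in> (\<lambda>x. x \<otimes> t) ` S"
        using Sd(3) tA by (intro image_eqI[of _ _ \<zero>]) auto
      show "x \<oplus> y \<in> (\<lambda>x. x \<otimes> t) ` S" if xy: "x \<in> (\<lambda>x. x \<otimes> t) ` S" "y \<in> (\<lambda>x. x \<otimes> t) ` S" for x y
      proof -
        obtain x' y' where "x' \<in> S" "y' \<in> S" "x = x' \<otimes> t" "y = y' \<otimes> t" using xy by blast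
        then show ?thesis
          using Sd(2,4) tA by (intro image_eqI[of _ _ "x' \<oplus> y'"]) (auto simp: A.l_distr subset_iff)
      qed
      show "c \<odot> x \<in> (\<lambda>x. x \<otimes> t) ` S" if c: "c \<in> carrier K" "x \<in> (\<lambda>x. x \<otimes> t) ` S" for c x
      proof -
        obtain x' where "x' \<in> S" "x = x' \<otimes> t" using c by blast
        then show ?thesis
          using Sd(2,5) tA c(1) by (intro image_eqI[of _ _ "c \<odot> x'"]) (auto simp: smult_mult_left subset_iff)
      qed
      show "a \<otimes> x \<in> (\<lambda>x. x \<otimes> t) ` S" if a: "a \<in> carrier A" "x \<in> (\<lambda>x. x \<otimes> t) ` S" for a x
      proof -
        obtain x' where "x' \<in> S" "x = x' \<otimes> t" using a by blast
        then show ?thesis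
          using Sd(2,6) tA a(1) by (intro image_eqI[of _ _ "a \<otimes> x'"]) (auto simp: A.m_assoc subset_iff)
      qed
    qed (use Sd(2) tA in auto)
    show "(\<lambda>x. x \<otimes> t) ` S \<noteq> {\<zero>}" using st by blast
    show "(\<lambda>x. x \<otimes> t) ` S \<subseteq> S" using st Sd(2,6) by auto
  qed
  then obtain e where e: "e \<in> S" "e \<otimes> t = t" using st(2) by force
  have eA: "e \<in> carrier A" using e Sd(2) by auto
  have e0: "e \<noteq> \<zero>" using e(2) st sA tA by auto
  \<comment> \<open>Right multiplication by \<open>t\<close> is injective on \<open>S\<close>: its
    kernel there is a left ideal that misses \<open>s\<close>, so minimality makes it zero.\<close>
  have ann: "x = \<zero>" if x: "x \<in> S" "x \<otimes> t = \<zero>" for x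
  proof (rule ccontr)
    assume "x \<noteq> \<zero>"
    let ?J = "{x \<in> S. x \<otimes> t = \<zero>}"
    have "left_ideal K A ?J"
      by (rule left_idealI)
        (use Sd tA in \<open>auto simp: A.l_distr smult_mult_left A.m_assoc subset_iff\<close>)
    then have "?J = S" using min x \<open>x \<noteq> \<zero>\<close> by blast
    then show False using st by blast
  qed
  \<comment> \<open>Since \<open>e \<otimes> t = t\<close>, the element
    \<open>e \<otimes> e \<ominus> e\<close> of \<open>S\<close> is killed by \<open>t\<close>,
    hence vanishes by \<open>ann\<close>.\<close>
  have "(e \<otimes> e \<ominus> e) \<otimes> t = \<zero>"
    using eA tA e(2) by (simp add: a_minus_def A.l_distr A.l_minus A.m_assoc A.r_neg)
  moreover have "e \<otimes> e \<ominus> e = (e \<ominus> \<one>) \<otimes> e"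
    using eA by (simp add: a_minus_def A.l_distr A.l_minus)
  then have "e \<otimes> e \<ominus> e \<in> S"
    using Sd(6)[of "e \<ominus> \<one>" e] e(1) eA by auto
  ultimately have "e \<otimes> e = e"
    using ann[of "e \<otimes> e \<ominus> e"] eA by simp
  \<comment> \<open>The left ideal generated by \<open>a \<otimes> e\<close> is nonzero and lies in
    \<open>S\<close>, so it is \<open>S\<close> and contains \<open>e\<close>.\<close>
  moreover have "\<exists>b \<in> carrier A. b \<otimes> (a \<otimes> e) = e" if a: "a \<in> carrier A" "a \<otimes> e \<noteq> \<zero>" for a
  proof -
    let ?x = "a \<otimes> e"
    have x: "?x \<in> S" "?x \<in> carrier A" using Sd(6) a e(1) eA by auto
    have "(\<lambda>b. b \<otimes> ?x) ` carrier A = S"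
    proof (rule min)
      show "left_ideal K A ((\<lambda>b. b \<otimes> ?x) ` carrier A)"
      proof (rule left_idealI)
        show "\<zero> \<in> (\<lambda>b. b \<otimes> ?x) ` carrier A"
          using x by (intro image_eqI[of _ _ \<zero>]) auto
        show "y \<oplus> z \<in> (\<lambda>b. b \<otimes> ?x) ` carrier A"
          if "y \<in> (\<lambda>b. b \<otimes> ?x) ` carrier A" "z \<in> (\<lambda>b. b \<otimes> ?x) ` carrier A" for y z
        proof -
          obtain y' z' where "y' \<in> carrier A" "z' \<in> carrier A" "y = y' \<otimes> ?x" "z = z' \<otimes> ?x"
            using \<open>y \<in> _\<close> \<open>z \<in> _\<close> by blast
          then show ?thesis
            using x(2) by (intro image_eqI[of _ _ "y' \<oplus> z'"]) (simp_all add: A.l_distr del: A.m_assoc)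
        qed
        show "c \<odot> y \<in> (\<lambda>b. b \<otimes> ?x) ` carrier A"
          if "c \<in> carrier K" "y \<in> (\<lambda>b. b \<otimes> ?x) ` carrier A" for c y
        proof -
          obtain y' where "y' \<in> carrier A" "y = y' \<otimes> ?x" using \<open>y \<in> _\<close> by blast
          then show ?thesis
            using x(2) \<open>c \<in> _\<close> by (intro image_eqI[of _ _ "c \<odot> y'"]) (simp_all add: smult_mult_left)
        qed
        show "b \<otimes> y \<in> (\<lambda>b. b \<otimes> ?x) ` carrier A"
          if "b \<in> carrier A" "y \<in> (\<lambda>b. b \<otimes> ?x) ` carrier A" for b y
        proof -
          obtain y' where "y' \<in> carrier A" "y = y' \<otimes> ?x" using \<open>y \<in> _\<close> by blast
          then show ?thesis
            using x(2) \<open>b \<in> _\<close> A.m_assoc[of b y' ?x]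
            by (intro image_eqI[of _ _ "b \<otimes> y'"]) simp_all
        qed
      qed (use x in auto)
      show "(\<lambda>b. b \<otimes> ?x) ` carrier A \<noteq> {\<zero>}"
      proof -
        have "\<one> \<otimes> ?x \<in> (\<lambda>b. b \<otimes> ?x) ` carrier A" by (rule imageI) simp
        then show ?thesis using a x(2) by auto
      qed
      show "(\<lambda>b. b \<otimes> ?x) ` carrier A \<subseteq> S" using x Sd(6) by auto
    qed
    then obtain b where "b \<in> carrier A" "e = b \<otimes> ?x" using e(1) by blast
    then show ?thesis by metis
  qed
  ultimately show thesis
    using e(1) SI e0 by (intro that[of e]) auto
qed

end

text \<open>Unital left modules over \<open>A\<close> on a vector space. The instance in view is the
  space of column vectors, with \<open>a\<close> acting by the matrix \<open>h a\<close> for a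
  homomorphism \<open>h\<close>.\<close>

locale algebra_module = assoc_algebra K A + W: vectorspace K W
  for K :: "'k ring" and A :: "('k, 'a) module" (structure) and W :: "('k, 'w) module" +
  fixes act :: "'a \<Rightarrow> 'w \<Rightarrow> 'w"
  assumes act_closed [simp]: "a \<in> carrier A \<Longrightarrow> w \<in> carrier W \<Longrightarrow> act a w \<in> carrier W"
    and act_one [simp]: "w \<in> carrier W \<Longrightarrow> act \<one> w = w"
    and act_mult: "a \<in> carrier A \<Longrightarrow> b \<in> carrier A \<Longrightarrow> w \<in> carrier W \<Longrightarrow> act (a \<otimes> b) w = act a (act b w)"
    and act_add_left: "a \<in> carrier A \<Longrightarrow> b \<in> carrier A \<Longrightarrow> w \<in> carrier W \<Longrightarrow>
      act (a \<oplus> b) w = act a w \<oplus>\<^bsub>W\<^esub> act b w"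
    and act_smult_left: "c \<in> carrier K \<Longrightarrow> a \<in> carrier A \<Longrightarrow> w \<in> carrier W \<Longrightarrow>
      act (c \<odot> a) w = c \<odot>\<^bsub>W\<^esub> act a w"
    and act_add_right: "a \<in> carrier A \<Longrightarrow> v \<in> carrier W \<Longrightarrow> w \<in> carrier W \<Longrightarrow>
      act a (v \<oplus>\<^bsub>W\<^esub> w) = act a v \<oplus>\<^bsub>W\<^esub> act a w"
begin

lemma linear_map_act: "w \<in> carrier W \<Longrightarrow> linear_map K A W (\<lambda>a. act a w)"
  by (rule linear_mapI)
    (auto simp: act_add_left act_smult_left intro: V.vectorspace_axioms W.vectorspace_axioms)

lemma act_zero_right [simp]: "a \<in> carrier A \<Longrightarrow> act a \<zero>\<^bsub>W\<^esub> = \<zero>\<^bsub>W\<^esub>"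
  using act_add_right[of a "\<zero>\<^bsub>W\<^esub>" "\<zero>\<^bsub>W\<^esub>"] by simp

lemma act_zero_left [simp]: "w \<in> carrier W \<Longrightarrow> act \<zero> w = \<zero>\<^bsub>W\<^esub>"
  using act_add_left[of \<zero> \<zero> w] by simp

lemma act_minus_left: "a \<in> carrier A \<Longrightarrow> w \<in> carrier W \<Longrightarrow> act (\<ominus> a) w = \<ominus>\<^bsub>W\<^esub> act a w"
  using act_add_left[of "\<ominus> a" a w] by (metis A.a_inv_closed A.l_neg W.M.minus_equality act_closed act_zero_left)

definition ann :: "'w \<Rightarrow> 'a set" where
  "ann w = {a \<in> carrier A. act a w = \<zero>\<^bsub>W\<^esub>}"

lemma left_ideal_ann: "w \<in> carrier W \<Longrightarrow> left_ideal K A (ann w)"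
  by (rule left_idealI) (auto simp: ann_def act_add_left act_smult_left act_mult)

text \<open>
  If \<open>e w\<close> lies outside \<open>A v\<close> for an idempotent \<open>e\<close> generating a minimal left ideal inside \<open>ann v\<close>,
  then \<open>A v\<close> and \<open>A e w\<close> intersect trivially, whence \<open>ann (v + e w)\<close> is \<open>{a \<in> ann v. a e = 0}\<close>.
\<close>

lemma ann_smaller:
  assumes simple: "simple_algebra K A" and fd: "V.fin_dim"
    and v: "v \<in> carrier W" and ann: "ann v \<noteq> {\<zero>}"
    and nsurj: "(\<lambda>a. act a v) ` carrier A \<noteq> carrier W"
  shows "\<exists>u \<in> carrier W. ann u \<subset> ann v"
proof -
  let ?Av = "(\<lambda>a. act a v) ` carrier A"
  obtain e where e: "e \<in> ann v" "e \<noteq> \<zero>" "e \<otimes> e = e"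
    and emin: "\<And>a. a \<in> carrier A \<Longrightarrow> a \<otimes> e \<noteq> \<zero> \<Longrightarrow> \<exists>b \<in> carrier A. b \<otimes> (a \<otimes> e) = e"
    using simple_idempotent[OF simple fd left_ideal_ann[OF v] ann] by blast
  have eA: "e \<in> carrier A" and ev: "act e v = \<zero>\<^bsub>W\<^esub>" using e(1) by (auto simp: ann_def)
  have Av_add: "x \<oplus>\<^bsub>W\<^esub> y \<in> ?Av" if xy: "x \<in> ?Av" "y \<in> ?Av" for x y
  proof -
    obtain a b where "a \<in> carrier A" "b \<in> carrier A" "x = act a v" "y = act b v" using xy by blast
    then show ?thesis using v by (intro image_eqI[of _ _ "a \<oplus> b"]) (auto simp: act_add_left)
  qed
  have Av_act: "act a x \<in> ?Av" if ax: "a \<in> carrier A" "x \<in> ?Av" for a x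
  proof -
    obtain b where "b \<in> carrier A" "x = act b v" using ax by blast
    then show ?thesis using v ax(1) by (intro image_eqI[of _ _ "a \<otimes> b"]) (auto simp: act_mult)
  qed
  have Av_zero: "\<zero>\<^bsub>W\<^esub> \<in> ?Av"
    using v by (intro image_eqI[of _ _ \<zero>]) auto
  \<comment> \<open>The elements sending all of \<open>W\<close> into \<open>?Av\<close> form a
    two-sided ideal \<open>?Q\<close>. If it contained \<open>e\<close>, it would be the whole
    algebra; then \<open>\<one> \<in> ?Q\<close> would put \<open>W\<close> inside
    \<open>?Av\<close>, against \<open>nsurj\<close>.\<close>
  have "\<exists>w \<in> carrier W. act e w \<notin> ?Av"
  proof (rule ccontr)
    assume all: "\<not> (\<exists>w \<in> carrier W. act e w \<notin> ?Av)"
    let ?Q = "{a \<in> carrier A. \<forall>w \<in> carrier W. act a w \<in> ?Av}"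
    have "ideal ?Q A"
    proof (rule ideal_of_closed)
      show "x \<oplus> y \<in> ?Q" if "x \<in> ?Q" "y \<in> ?Q" for x y
        using that Av_add by (auto simp: act_add_left simp del: image_iff)
      show "a \<otimes> x \<in> ?Q" if "a \<in> carrier A" "x \<in> ?Q" for a x
        using that Av_act by (auto simp: act_mult simp del: image_iff)
      show "x \<otimes> a \<in> ?Q" if "a \<in> carrier A" "x \<in> ?Q" for a x
        using that by (auto simp: act_mult simp del: image_iff)
    qed (use Av_zero in auto)
    moreover have "e \<in> ?Q" using all eA by blast
    ultimately have "?Q = carrier A"
      using simple e(2) unfolding simple_algebra_def by blast
    then have "\<one> \<in> ?Q" by simp
    then have "w \<in> ?Av" if "w \<in> carrier W" for w
      using that act_one[OF that] by (metis (no_types, lifting) mem_Collect_eq)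
    then show False using nsurj v by auto
  qed
  then obtain w where w: "w \<in> carrier W" and ew: "act e w \<notin> ?Av" by blast
  let ?u = "v \<oplus>\<^bsub>W\<^esub> act e w"
  have sub: "ann ?u \<subseteq> ann v"
  proof
    fix a assume "a \<in> ann ?u"
    then have a: "a \<in> carrier A" and "act a ?u = \<zero>\<^bsub>W\<^esub>" by (auto simp: ann_def)
    then have sum: "act a v \<oplus>\<^bsub>W\<^esub> act (a \<otimes> e) w = \<zero>\<^bsub>W\<^esub>"
      using v w eA by (simp add: act_add_right act_mult)
    \<comment> \<open>Otherwise some \<open>b\<close> recovers \<open>e\<close> from
      \<open>a \<otimes> e\<close>. Applying \<open>b\<close> to the relation \<open>sum\<close>
      then expresses \<open>act e w\<close> as an element of \<open>?Av\<close>, against the choice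
      of \<open>w\<close>.\<close>
    have "a \<otimes> e = \<zero>"
    proof (rule ccontr)
      assume "a \<otimes> e \<noteq> \<zero>"
      then obtain b where b: "b \<in> carrier A" "b \<otimes> (a \<otimes> e) = e" using emin a by blast
      have "act (a \<otimes> e) w = act (\<ominus> a) v"
        using sum v w a eA act_minus_left[OF a v]
        by (metis A.m_closed W.M.minus_equality W.M.a_comm act_closed)
      then have "act (b \<otimes> (a \<otimes> e)) w \<in> ?Av"
        using a b v w eA Av_act[of b "act (\<ominus> a) v"] by (subst act_mult) auto
      with ew b show False by simp
    qed
    with sum v w a show "a \<in> ann v" by (auto simp: ann_def)
  qed
  \<comment> \<open>The inclusion is strict because of \<open>e\<close> itself: it kills
    \<open>v\<close>, but sends \<open>?u\<close> outside \<open>?Av\<close>, hence not to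
    zero.\<close>
  have "act e ?u = act e w"
    using v w eA ev e(3) by (simp add: act_add_right flip: act_mult)
  then have "e \<notin> ann ?u"
    using ew Av_zero by (auto simp: ann_def)
  then show ?thesis using sub e(1) v w eA by (intro bexI[of _ ?u]) auto
qed

text \<open>Take \<open>v\<close> with annihilator of least dimension. If the annihilator is zero,
  the orbit map is injective; if not, \<open>ann_smaller\<close> forces it to be surjective. As the
  dimensions agree, either property yields bijectivity.\<close>

lemma ex_cyclic_vector:
  assumes simple: "simple_algebra K A" and fd: "V.fin_dim" "W.fin_dim" and dim: "V.dim = W.dim"
  obtains v where "v \<in> carrier W" "bij_betw (\<lambda>a. act a v) (carrier A) (carrier W)"
proof -
  \<comment> \<open>The zero vector serves only to show that there is a candidate to minimise
    over.\<close>
  have "\<exists>v. v \<in> carrier W \<and> (\<forall>u. u \<in> carrier W \<longrightarrow>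
      vectorspace.dim K (V.vs (ann v)) \<le> vectorspace.dim K (V.vs (ann u)))"
    by (rule ex_has_least_nat[of _ "\<zero>\<^bsub>W\<^esub>"]) simp
  then obtain v where v: "v \<in> carrier W" and least: "\<And>u. u \<in> carrier W \<Longrightarrow>
      vectorspace.dim K (V.vs (ann v)) \<le> vectorspace.dim K (V.vs (ann u))"
    by blast
  interpret T: linear_map K A W "\<lambda>a. act a v" using v by (rule linear_map_act)
  have ker: "T.kerT = ann v" by (simp add: T.ker_def ann_def)
  have "inj_on (\<lambda>a. act a v) (carrier A)"
  proof (cases "ann v = {\<zero>}")
    case True
    then show ?thesis by (intro T.Ke0_imp_inj) (simp add: ker)
  next
    case False
    have "\<not> (\<exists>u \<in> carrier W. ann u \<subset> ann v)"
    proof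
      assume "\<exists>u \<in> carrier W. ann u \<subset> ann v"
      then obtain u where u: "u \<in> carrier W" "ann u \<subset> ann v" by blast
      then have "vectorspace.dim K (V.vs (ann u)) < vectorspace.dim K (V.vs (ann v))"
        using V.dim_subspace_strict_mono[OF fd(1)] left_ideal_ann left_idealD(1) v by blast
      with least[OF u(1)] show False by simp
    qed
    then have "(\<lambda>a. act a v) ` carrier A = carrier W"
      using ann_smaller[OF simple fd(1) v False] by blast
    then show ?thesis by (rule T.surj_imp_inj[OF fd(1) dim])
  qed
  then show thesis
    using T.inj_imp_surj[OF fd dim] v by (intro that[of v]) (auto simp: bij_betw_def)
qed

end

subsection \<open>Matrices of linear maps\<close>

lemma mult_mat_unit_vec:
  fixes A :: "'k::semiring_1 mat"
  assumes "A \<in> carrier_mat nr nc" "j < nc"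
  shows "A *\<^sub>v unit_vec nc j = col A j"
  using assms by (intro eq_vecI) (auto simp: scalar_prod_right_unit)

locale based_space = vectorspace class_ring V
  for V :: "('k::field, 'a) module" +
  fixes bs :: "'a list"
  assumes ordered_basis: "ordered_basis class_ring V bs"
begin

abbreviation N :: nat where "N \<equiv> length bs"

definition coord_vec :: "'a \<Rightarrow> 'k vec" where
  "coord_vec x = vec N (\<lambda>i. coordinates class_ring V bs x (bs ! i))"

lemma distinct_bs: "distinct bs" and basis_bs: "basis (set bs)" and bs_subset: "set bs \<subseteq> carrier V"
  using ordered_basis by (auto simp: ordered_basis_def basis_def)

lemma nth_bs_closed [simp]: "j < N \<Longrightarrow> bs ! j \<in> carrier V"
  using bs_subset by auto

lemma fin_dim_bs: "fin_dim" and dim_bs: "dim = N"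
  using basis_bs dim_basis[OF _ basis_bs] distinct_card[OF distinct_bs]
  by (auto simp: fin_dim_def basis_def)

lemma coord_vec_closed [simp]: "coord_vec x \<in> carrier_vec N"
  by (simp add: coord_vec_def)

lemma lincomb_coordinates:
  "x \<in> carrier V \<Longrightarrow> lincomb (coordinates class_ring V bs x) (set bs) = x"
  using coordinates(2)[OF vectorspace_axioms ordered_basis] .

text \<open>\<open>coordinates\<close> is a definite description over extensional functions, so
  \<open>c\<close> is first restricted to \<open>set bs\<close>; uniqueness of the expansion then
  applies.\<close>

lemma coordinates_eqI:
  assumes "lincomb c (set bs) = x" "b \<in> set bs"
  shows "coordinates class_ring V bs x b = c b"
proof -
  have x: "x \<in> carrier V" using assms(1) bs_subset by auto
  let ?c = "restrict c (set bs)"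
  have "lincomb ?c (set bs) = x"
    unfolding assms(1)[symmetric] by (rule lincomb_cong) (use bs_subset in auto)
  moreover have "\<exists>!c. c \<in> set bs \<rightarrow>\<^sub>E carrier class_ring \<and> lincomb c (set bs) = x"
    using basis_criterion[of "set bs"] basis_bs bs_subset x by blast
  ultimately have "coordinates class_ring V bs x = ?c"
    using coordinates[OF vectorspace_axioms ordered_basis x] by auto
  with assms(2) show ?thesis by simp
qed

lemma coord_vec_basis: "j < N \<Longrightarrow> coord_vec (bs ! j) = unit_vec N j"
proof -
  assume j: "j < N"
  \<comment> \<open>The indicator of \<open>bs ! j\<close>. Splitting off this basis vector leaves a
    combination with zero coefficients.\<close>
  let ?d = "\<lambda>b. if b = bs ! j then 1 else 0 :: 'k"
  have "lincomb ?d (set bs) = ?d (bs ! j) \<odot>\<^bsub>V\<^esub> (bs ! j) \<oplus>\<^bsub>V\<^esub> lincomb ?d (set bs - {bs ! j})"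
    using j bs_subset by (intro lincomb_del2) auto
  also have "lincomb ?d (set bs - {bs ! j}) = lincomb (\<lambda>_. \<zero>\<^bsub>class_ring\<^esub>) (set bs - {bs ! j})"
    using bs_subset by (intro lincomb_cong) auto
  also have "\<dots> = \<zero>\<^bsub>V\<^esub>"
    using bs_subset by (intro lincomb_zero) auto
  finally have lc: "lincomb ?d (set bs) = bs ! j"
    using j smult_one[of "bs ! j"] by simp
  show ?thesis
    using coordinates_eqI[OF lc] j nth_eq_iff_index_eq[OF distinct_bs]
    by (intro eq_vecI) (auto simp: coord_vec_def)
qed

lemma linear_map_coord_vec: "linear_map class_ring V (module_vec TYPE('k) N) coord_vec"
proof (rule linear_mapI[OF vectorspace_axioms vec_vs])
  fix v w assume v: "v \<in> carrier V" and w: "w \<in> carrier V"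
  let ?c = "coordinates class_ring V bs"
  have "lincomb (\<lambda>b. ?c v b \<oplus>\<^bsub>class_ring\<^esub> ?c w b) (set bs) = v \<oplus>\<^bsub>V\<^esub> w"
    by (subst lincomb_sum) (use bs_subset v w lincomb_coordinates in auto)
  from coordinates_eqI[OF this] show "coord_vec (v \<oplus>\<^bsub>V\<^esub> w) = coord_vec v \<oplus>\<^bsub>module_vec TYPE('k) N\<^esub> coord_vec w"
    by (intro eq_vecI) (auto simp: coord_vec_def module_vec_simps)
next
  fix c :: 'k and v assume v: "v \<in> carrier V"
  let ?c = "coordinates class_ring V bs"
  have "lincomb (\<lambda>b. c \<otimes>\<^bsub>class_ring\<^esub> ?c v b) (set bs) = c \<odot>\<^bsub>V\<^esub> v"
    by (subst lincomb_smult) (use bs_subset v lincomb_coordinates in auto)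
  from coordinates_eqI[OF this] show "coord_vec (c \<odot>\<^bsub>V\<^esub> v) = c \<odot>\<^bsub>module_vec TYPE('k) N\<^esub> coord_vec v"
    by (intro eq_vecI) (auto simp: coord_vec_def module_vec_simps)
qed (simp add: module_vec_simps)

lemma inj_coord_vec: "inj_on coord_vec (carrier V)"
proof (rule inj_onI)
  fix v w assume v: "v \<in> carrier V" and w: "w \<in> carrier V" and eq: "coord_vec v = coord_vec w"
  have nth: "coordinates class_ring V bs v (bs ! i) = coordinates class_ring V bs w (bs ! i)" if "i < N" for i
    using arg_cong[OF eq, of "\<lambda>u. u $ i"] that by (simp add: coord_vec_def)
  have "lincomb (coordinates class_ring V bs v) (set bs) = lincomb (coordinates class_ring V bs w) (set bs)"
    by (rule lincomb_cong) (use nth bs_subset in \<open>auto simp: in_set_conv_nth\<close>)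
  then show "v = w" using v w by (simp add: lincomb_coordinates)
qed

text \<open>An injective linear map between spaces of equal dimension is onto. Later this turns an
  arbitrary column into the coordinates of an algebra element.\<close>

lemma coord_vec_image: "coord_vec ` carrier V = carrier_vec N"
proof -
  interpret W: vec_space "TYPE('k)" N .
  interpret T: linear_map class_ring V "module_vec TYPE('k) N" coord_vec
    by (rule linear_map_coord_vec)
  show ?thesis
    using T.inj_imp_surj[OF fin_dim_bs W.fin_dim _ inj_coord_vec] dim_bs W.dim_is_n
    by (simp add: module_vec_simps)
qed

text \<open>Both sides are linear in \<open>x\<close>. At \<open>bs ! j\<close> the coordinate
  vector is a unit vector, which picks out column \<open>j\<close>.\<close>

lemma mat_of_cols_mult_coord_vec:
  assumes T: "linear_map class_ring V (module_vec TYPE('k) N) T" and x: "x \<in> carrier V"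
  shows "mat_of_cols N (map T bs) *\<^sub>v coord_vec x = T x"
proof (rule linear_map_eq_on_basis[OF _ T basis_bs _ x])
  interpret C: linear_map class_ring V "module_vec TYPE('k) N" coord_vec
    by (rule linear_map_coord_vec)
  interpret T: linear_map class_ring V "module_vec TYPE('k) N" T by (fact T)
  let ?M = "mat_of_cols N (map T bs)"
  have M: "?M \<in> carrier_mat N N" using mat_of_cols_carrier(1)[of N "map T bs"] by simp
  show "linear_map class_ring V (module_vec TYPE('k) N) (\<lambda>x. ?M *\<^sub>v coord_vec x)"
    by (rule linear_mapI[OF vectorspace_axioms vec_vs])
      (use M C.T_add C.T_smult in \<open>auto simp: module_vec_simps mult_add_distrib_mat_vec mult_mat_vec\<close>)
  show "?M *\<^sub>v coord_vec b = T b" if b: "b \<in> set bs" for b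
  proof -
    obtain j where j: "j < N" "b = bs ! j" using b by (auto simp: in_set_conv_nth)
    have "T b \<in> carrier_vec N" using T.T_im[of b] j by (simp add: module_vec_simps)
    then show ?thesis
      using j M by (simp add: coord_vec_basis mult_mat_unit_vec)
  qed
qed

lemma matrix_of_end_closed [simp]: "matrix_of_end class_ring V bs f \<in> carrier_mat N N"
  by (simp add: matrix_of_end_def)

text \<open>The columns of the matrix are the values of \<open>coord_vec \<circ> f\<close> on the
  basis, so the preceding lemma applies to that map.\<close>

lemma matrix_of_end_mult_coord_vec:
  assumes f: "linear_map class_ring V V f" and x: "x \<in> carrier V"
  shows "matrix_of_end class_ring V bs f *\<^sub>v coord_vec x = coord_vec (f x)"
proof -
  interpret f: linear_map class_ring V V f by fact
  interpret C: linear_map class_ring V "module_vec TYPE('k) N" coord_vec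
    by (rule linear_map_coord_vec)
  have "linear_map class_ring V (module_vec TYPE('k) N) (coord_vec \<circ> f)"
    by (rule linear_mapI[OF vectorspace_axioms vec_vs])
      (use f.T_im in \<open>simp_all add: module_vec_simps\<close>)
  moreover have "matrix_of_end class_ring V bs f = mat_of_cols N (map (coord_vec \<circ> f) bs)"
    by (rule eq_matI) (auto simp: matrix_of_end_def mat_of_cols_def coord_vec_def)
  ultimately show ?thesis using mat_of_cols_mult_coord_vec[OF _ x, of "coord_vec \<circ> f"] by simp
qed

text \<open>The unit vectors are the coordinates of the basis, so the columns agree. Matrix
  identities below are thereby reduced to identities in the algebra.\<close>

lemma mat_eqI_coord_vec:
  assumes A: "A \<in> carrier_mat N N" and B: "B \<in> carrier_mat N N"
    and eq: "\<And>x. x \<in> carrier V \<Longrightarrow> A *\<^sub>v coord_vec x = B *\<^sub>v coord_vec x"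
  shows "A = B"
proof (rule mat_col_eqI)
  fix j assume "j < dim_col B"
  then have j: "j < N" using B by simp
  then show "col A j = col B j"
    using eq[of "bs ! j"] A B by (simp add: coord_vec_basis mult_mat_unit_vec)
qed (use A B in auto)

end

subsection \<open>Homomorphisms of algebras\<close>

text \<open>Unital, as \<open>Ring.ring_hom\<close> preserves the one. Anti-homomorphisms appear
  below as homomorphisms into an opposite algebra.\<close>

definition algebra_hom :: "'k ring \<Rightarrow> ('k, 'a) module \<Rightarrow> ('k, 'b) module \<Rightarrow> ('a \<Rightarrow> 'b) set" where
  "algebra_hom K A B =
     {h \<in> Ring.ring_hom A B. \<forall>c \<in> carrier K. \<forall>x \<in> carrier A. h (c \<odot>\<^bsub>A\<^esub> x) = c \<odot>\<^bsub>B\<^esub> h x}"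

lemma algebra_homI:
  assumes "\<And>x. x \<in> carrier A \<Longrightarrow> h x \<in> carrier B"
    and "\<And>x y. x \<in> carrier A \<Longrightarrow> y \<in> carrier A \<Longrightarrow> h (x \<otimes>\<^bsub>A\<^esub> y) = h x \<otimes>\<^bsub>B\<^esub> h y"
    and "\<And>x y. x \<in> carrier A \<Longrightarrow> y \<in> carrier A \<Longrightarrow> h (x \<oplus>\<^bsub>A\<^esub> y) = h x \<oplus>\<^bsub>B\<^esub> h y"
    and "h \<one>\<^bsub>A\<^esub> = \<one>\<^bsub>B\<^esub>"
    and "\<And>c x. c \<in> carrier K \<Longrightarrow> x \<in> carrier A \<Longrightarrow> h (c \<odot>\<^bsub>A\<^esub> x) = c \<odot>\<^bsub>B\<^esub> h x"
  shows "h \<in> algebra_hom K A B"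
  using assms by (auto simp: algebra_hom_def intro!: Ring.ring_hom_memI)

lemma algebra_homD:
  assumes "h \<in> algebra_hom K A B"
  shows "x \<in> carrier A \<Longrightarrow> h x \<in> carrier B"
    and "x \<in> carrier A \<Longrightarrow> y \<in> carrier A \<Longrightarrow> h (x \<otimes>\<^bsub>A\<^esub> y) = h x \<otimes>\<^bsub>B\<^esub> h y"
    and "x \<in> carrier A \<Longrightarrow> y \<in> carrier A \<Longrightarrow> h (x \<oplus>\<^bsub>A\<^esub> y) = h x \<oplus>\<^bsub>B\<^esub> h y"
    and "h \<one>\<^bsub>A\<^esub> = \<one>\<^bsub>B\<^esub>"
    and "c \<in> carrier K \<Longrightarrow> x \<in> carrier A \<Longrightarrow> h (c \<odot>\<^bsub>A\<^esub> x) = c \<odot>\<^bsub>B\<^esub> h x"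
proof -
  have h: "h \<in> Ring.ring_hom A B" using assms by (simp add: algebra_hom_def)
  show "x \<in> carrier A \<Longrightarrow> h x \<in> carrier B"
    and "x \<in> carrier A \<Longrightarrow> y \<in> carrier A \<Longrightarrow> h (x \<otimes>\<^bsub>A\<^esub> y) = h x \<otimes>\<^bsub>B\<^esub> h y"
    and "x \<in> carrier A \<Longrightarrow> y \<in> carrier A \<Longrightarrow> h (x \<oplus>\<^bsub>A\<^esub> y) = h x \<oplus>\<^bsub>B\<^esub> h y"
    and "h \<one>\<^bsub>A\<^esub> = \<one>\<^bsub>B\<^esub>"
    using h by (simp_all add: Ring.ring_hom_def Pi_iff)
  show "c \<in> carrier K \<Longrightarrow> x \<in> carrier A \<Longrightarrow> h (c \<odot>\<^bsub>A\<^esub> x) = c \<odot>\<^bsub>B\<^esub> h x"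
    using assms by (simp add: algebra_hom_def)
qed

lemma algebra_hom_comp:
  assumes "f \<in> algebra_hom K A B" "g \<in> algebra_hom K B C"
  shows "g \<circ> f \<in> algebra_hom K A C"
  by (rule algebra_homI) (simp_all add: algebra_homD[OF assms(1)] algebra_homD[OF assms(2)])

lemma algebra_hom_linear_map:
  assumes "h \<in> algebra_hom K A B" "assoc_algebra K A" "assoc_algebra K B"
  shows "linear_map K A B h"
  by (rule linear_mapI) (use assms(2,3) in \<open>simp_all add: assoc_algebra_def algebra_homD[OF assms(1)]\<close>)

text \<open>The kernel is a two-sided ideal that misses the one, hence is zero.\<close>

lemma simple_algebra_hom_inj:
  assumes "simple_algebra K A" "h \<in> algebra_hom K A B" "assoc_algebra K B" "\<one>\<^bsub>B\<^esub> \<noteq> \<zero>\<^bsub>B\<^esub>"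
  shows "inj_on h (carrier A)"
proof -
  have "ring A" "ring B" "h \<in> Ring.ring_hom A B"
    using assms by (simp_all add: simple_algebra_def assoc_algebra_def algebra_hom_def)
  then have hom: "ring_hom_ring A B h" by (rule ring_hom_ringI2)
  have "\<one>\<^bsub>A\<^esub> \<notin> a_kernel A B h"
    using assms(4) algebra_homD(4)[OF assms(2)] by (simp add: a_kernel_def')
  moreover have "\<one>\<^bsub>A\<^esub> \<in> carrier A"
    using \<open>ring A\<close> by (simp add: ring.ring_simprules(6))
  ultimately have "a_kernel A B h \<noteq> carrier A" by blast
  then have "a_kernel A B h = {\<zero>\<^bsub>A\<^esub>}"
    using assms(1) ring_hom_ring.kernel_is_ideal[OF hom] unfolding simple_algebra_def by blast
  then show ?thesis by (rule ring_hom_ring.trivial_ker_imp_inj[OF hom])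
qed

text \<open>With \<open>B\<close> an opposite matrix algebra, \<open>f\<close> and \<open>g\<close>
  are anti-embeddings into matrices, and the two reversals of products cancel. The lemma yields both
  \<chi> and \<chi>'.\<close>

lemma algebra_iso_inv_into_comp:
  assumes A: "assoc_algebra K A" and C: "assoc_algebra K C"
    and f: "f \<in> algebra_hom K A B" "inj_on f (carrier A)"
    and g: "g \<in> algebra_hom K C B" "inj_on g (carrier C)"
    and img: "g ` carrier C = f ` carrier A"
  shows "inv_into (carrier A) f \<circ> g \<in> algebra_iso K C A"
proof -
  interpret A: assoc_algebra K A by fact
  interpret C: assoc_algebra K C by fact
  let ?h = "inv_into (carrier A) f \<circ> g"
  note fD = algebra_homD[OF f(1)] and gD = algebra_homD[OF g(1)]
  have hA: "?h x \<in> carrier A" and fh: "f (?h x) = g x" if "x \<in> carrier C" for x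
    using that img inv_into_into[of "g x" f "carrier A"] f_inv_into_f[of "g x" f "carrier A"] by auto
  \<comment> \<open>Each homomorphism law for \<open>?h\<close> is checked after applying the
    injective map \<open>f\<close>.\<close>
  have eqI: "?h x = y" if "x \<in> carrier C" "y \<in> carrier A" "f y = g x" for x y
    using that f(2) by (metis comp_apply inv_into_f_f)
  have "?h \<in> algebra_hom K C A"
  proof (rule algebra_homI)
    show "?h \<one>\<^bsub>C\<^esub> = \<one>\<^bsub>A\<^esub>" by (rule eqI) (simp_all add: fD gD)
    show "?h (x \<otimes>\<^bsub>C\<^esub> y) = ?h x \<otimes>\<^bsub>A\<^esub> ?h y" if "x \<in> carrier C" "y \<in> carrier C" for x y
      by (rule eqI) (use that hA fh in \<open>simp_all add: fD(2) gD(2) del: comp_apply\<close>)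
    show "?h (x \<oplus>\<^bsub>C\<^esub> y) = ?h x \<oplus>\<^bsub>A\<^esub> ?h y" if "x \<in> carrier C" "y \<in> carrier C" for x y
      by (rule eqI) (use that hA fh in \<open>simp_all add: fD(3) gD(3) del: comp_apply\<close>)
    show "?h (c \<odot>\<^bsub>C\<^esub> x) = c \<odot>\<^bsub>A\<^esub> ?h x" if "c \<in> carrier K" "x \<in> carrier C" for c x
      by (rule eqI) (use that hA fh in \<open>simp_all add: fD(5) gD(5) del: comp_apply\<close>)
  qed (use hA in auto)
  moreover have "bij_betw ?h (carrier C) (carrier A)"
  proof -
    have "bij_betw g (carrier C) (f ` carrier A)" using g(2) img by (simp add: bij_betw_def)
    moreover have "bij_betw (inv_into (carrier A) f) (f ` carrier A) (carrier A)"
      using f(2) by (intro bij_betw_inv_into) (simp add: bij_betw_def)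
    ultimately show ?thesis by (rule bij_betw_trans)
  qed
  ultimately show ?thesis
    by (auto simp: algebra_iso_def algebra_hom_def ring_iso_def)
qed

text \<open>The inverse of \<open>f\<close> after \<open>g\<close> is an injective linear map
  between spaces of equal dimension, hence onto.\<close>

lemma linear_inj_images_eq:
  assumes f: "linear_map K U W f" "inj_on f (carrier U)" "vectorspace.fin_dim K U"
    and g: "linear_map K V W g" "inj_on g (carrier V)" "vectorspace.fin_dim K V"
    and dim: "vectorspace.dim K U = vectorspace.dim K V"
    and sub: "g ` carrier V \<subseteq> f ` carrier U"
  shows "g ` carrier V = f ` carrier U"
proof -
  interpret U: vectorspace K U using f(1) by (simp add: linear_map_def)
  interpret V: vectorspace K V using g(1) by (simp add: linear_map_def)
  interpret f: linear_map K U W f by fact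
  interpret g: linear_map K V W g by fact
  let ?h = "inv_into (carrier U) f \<circ> g"
  have hU: "?h x \<in> carrier U" and fh: "f (?h x) = g x" if "x \<in> carrier V" for x
    using that sub inv_into_into[of "g x" f "carrier U"] f_inv_into_f[of "g x" f "carrier U"] by auto
  have eqI: "?h x = y" if "y \<in> carrier U" "f y = g x" for x y
    using that f(2) by (metis comp_apply inv_into_f_f)
  have "linear_map K V U ?h"
  proof (rule linear_mapI[OF V.vectorspace_axioms U.vectorspace_axioms])
    show "?h (x \<oplus>\<^bsub>V\<^esub> y) = ?h x \<oplus>\<^bsub>U\<^esub> ?h y" if "x \<in> carrier V" "y \<in> carrier V" for x y
      by (rule eqI) (use that hU fh in \<open>simp_all del: comp_apply\<close>)
    show "?h (c \<odot>\<^bsub>V\<^esub> x) = c \<odot>\<^bsub>U\<^esub> ?h x" if "c \<in> carrier K" "x \<in> carrier V" for c x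
      by (rule eqI) (use that hU fh in \<open>simp_all del: comp_apply\<close>)
  qed (rule hU)
  then interpret h: linear_map K V U ?h .
  have "inj_on ?h (carrier V)"
    using fh g(2) by (metis inj_on_def)
  then have "?h ` carrier V = carrier U"
    by (rule h.inj_imp_surj[OF g(3) f(3) dim[symmetric]])
  then have "f ` carrier U = (\<lambda>x. f (?h x)) ` carrier V" by (metis image_image)
  also have "\<dots> = g ` carrier V" using fh by (intro image_cong) auto
  finally show ?thesis by simp
qed

lemma smult_mat_mult_vec:
  fixes A :: "'k::semiring_1 mat"
  assumes "A \<in> carrier_mat nr nc" "v \<in> carrier_vec nc"
  shows "(c \<cdot>\<^sub>m A) *\<^sub>v v = c \<cdot>\<^sub>v (A *\<^sub>v v)"
  using assms by (intro eq_vecI) (auto simp: scalar_prod_def sum_distrib_left mult.assoc)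

subsection \<open>The regular representations\<close>

locale based_algebra = assoc_algebra class_ring A + based_space A bs
  for A :: "('k::field, 'a) module" (structure) and bs :: "'a list"
begin

abbreviation M :: "('k, 'k mat) module" where "M \<equiv> mat_algebra TYPE('k) N"

abbreviation left_mat :: "'a \<Rightarrow> 'k mat" where
  "left_mat a \<equiv> matrix_of_end class_ring A bs (left_regular A a)"

abbreviation right_mat :: "'a \<Rightarrow> 'k mat" where
  "right_mat a \<equiv> matrix_of_end class_ring A bs (right_regular A a)"

lemma left_mat_mult_coord_vec:
  assumes "a \<in> carrier A" "x \<in> carrier A"
  shows "left_mat a *\<^sub>v coord_vec x = coord_vec (a \<otimes> x)"
proof -
  have "linear_map class_ring A A (left_regular A a)"
    by (rule linear_mapI)
      (use assms V.vectorspace_axioms in \<open>auto simp: left_regular_def A.r_distr smult_mult_right\<close>)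
  from matrix_of_end_mult_coord_vec[OF this assms(2)] show ?thesis
    by (simp add: left_regular_def)
qed

lemma right_mat_mult_coord_vec:
  assumes "a \<in> carrier A" "x \<in> carrier A"
  shows "right_mat a *\<^sub>v coord_vec x = coord_vec (x \<otimes> a)"
proof -
  have "linear_map class_ring A A (right_regular A a)"
    by (rule linear_mapI)
      (use assms V.vectorspace_axioms in \<open>auto simp: right_regular_def A.l_distr smult_mult_left\<close>)
  from matrix_of_end_mult_coord_vec[OF this assms(2)] show ?thesis
    by (simp add: right_regular_def)
qed

lemma coord_vec_add: "x \<in> carrier A \<Longrightarrow> y \<in> carrier A \<Longrightarrow> coord_vec (x \<oplus> y) = coord_vec x + coord_vec y"
  and coord_vec_smult: "x \<in> carrier A \<Longrightarrow> coord_vec (c \<odot> x) = c \<cdot>\<^sub>v coord_vec x"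
proof -
  interpret C: linear_map class_ring A "module_vec TYPE('k) N" coord_vec
    by (rule linear_map_coord_vec)
  show "x \<in> carrier A \<Longrightarrow> y \<in> carrier A \<Longrightarrow> coord_vec (x \<oplus> y) = coord_vec x + coord_vec y"
    using C.T_add by (simp add: module_vec_simps)
  show "x \<in> carrier A \<Longrightarrow> coord_vec (c \<odot> x) = c \<cdot>\<^sub>v coord_vec x"
    using C.T_smult[of c x] by (simp add: module_vec_simps)
qed

text \<open>Right multiplication by \<open>a \<otimes> b\<close> applies \<open>a\<close> first and
  \<open>b\<close> second, the reverse of the order in a matrix product; hence the opposite algebra
  as target.\<close>

lemma right_mat_hom: "right_mat \<in> algebra_hom class_ring A (opposite_algebra M)"
proof (rule algebra_homI)
  fix a b assume a: "a \<in> carrier A" and b: "b \<in> carrier A"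
  show "right_mat (a \<otimes> b) = right_mat a \<otimes>\<^bsub>opposite_algebra M\<^esub> right_mat b"
    using a b unfolding opposite_algebra_def
    by (intro mat_eqI_coord_vec)
      (auto simp: module_mat_simps right_mat_mult_coord_vec A.m_assoc mult_carrier_mat[of _ N N]
        assoc_mult_mat_vec[of _ N N _ N])
  show "right_mat (a \<oplus> b) = right_mat a \<oplus>\<^bsub>opposite_algebra M\<^esub> right_mat b"
    using a b unfolding opposite_algebra_def
    by (intro mat_eqI_coord_vec)
      (auto simp: module_mat_simps right_mat_mult_coord_vec A.r_distr coord_vec_add
        add_mult_distrib_mat_vec[of _ N N])
next
  fix c :: 'k and a assume a: "a \<in> carrier A"
  show "right_mat (c \<odot> a) = c \<odot>\<^bsub>opposite_algebra M\<^esub> right_mat a"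
  proof (rule mat_eqI_coord_vec)
    fix x assume x: "x \<in> carrier A"
    have "right_mat (c \<odot> a) *\<^sub>v coord_vec x = c \<cdot>\<^sub>v (right_mat a *\<^sub>v coord_vec x)"
      using a x by (simp add: right_mat_mult_coord_vec smult_mult_right coord_vec_smult)
    also have "\<dots> = (c \<cdot>\<^sub>m right_mat a) *\<^sub>v coord_vec x"
      by (rule smult_mat_mult_vec[OF matrix_of_end_closed coord_vec_closed, symmetric])
    finally show "right_mat (c \<odot> a) *\<^sub>v coord_vec x = (c \<odot>\<^bsub>opposite_algebra M\<^esub> right_mat a) *\<^sub>v coord_vec x"
      by (simp add: opposite_algebra_def module_mat_simps)
  qed (auto simp: opposite_algebra_def module_mat_simps)
next
  show "right_mat \<one> = \<one>\<^bsub>opposite_algebra M\<^esub>"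
    unfolding opposite_algebra_def
    by (intro mat_eqI_coord_vec) (auto simp: module_mat_simps right_mat_mult_coord_vec)
qed (simp add: opposite_algebra_def module_mat_simps)

text \<open>Evaluation at \<open>\<one>\<close> recovers \<open>a\<close>.\<close>

lemma inj_right_mat: "inj_on right_mat (carrier A)"
proof (rule inj_onI)
  fix a b assume a: "a \<in> carrier A" "b \<in> carrier A" and eq: "right_mat a = right_mat b"
  have "coord_vec a = coord_vec b"
    using right_mat_mult_coord_vec[of a \<one>] right_mat_mult_coord_vec[of b \<one>] a eq by simp
  then show "a = b" using inj_coord_vec a by (auto dest: inj_onD)
qed

text \<open>A matrix commuting with all left multiplications is determined by its value
  \<open>c\<close> at \<open>\<one>\<close>: writing \<open>x\<close> as
  \<open>x \<otimes> \<one>\<close> and moving \<open>left_mat x\<close> past \<open>C\<close> shows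
  that it sends \<open>x\<close> to \<open>x \<otimes> c\<close>.\<close>

lemma commutant_left_mat:
  assumes C: "C \<in> carrier_mat N N"
    and comm: "\<And>a. a \<in> carrier A \<Longrightarrow> C * left_mat a = left_mat a * C"
  shows "C \<in> right_mat ` carrier A"
proof -
  have "C *\<^sub>v coord_vec \<one> \<in> coord_vec ` carrier A"
    using C by (simp add: coord_vec_image)
  then obtain c where c: "c \<in> carrier A" "C *\<^sub>v coord_vec \<one> = coord_vec c" by blast
  have "C = right_mat c"
  proof (rule mat_eqI_coord_vec[OF C])
    fix x assume x: "x \<in> carrier A"
    have "C *\<^sub>v coord_vec x = (C * left_mat x) *\<^sub>v coord_vec \<one>"
      using C x by (simp add: left_mat_mult_coord_vec assoc_mult_mat_vec[of _ N N _ N])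
    also have "\<dots> = coord_vec (x \<otimes> c)"
      using C x c by (simp add: comm left_mat_mult_coord_vec assoc_mult_mat_vec[of _ N N _ N])
    finally show "C *\<^sub>v coord_vec x = right_mat c *\<^sub>v coord_vec x"
      using x c by (simp add: right_mat_mult_coord_vec)
  qed simp
  with c show ?thesis by blast
qed

text \<open>For a cyclic vector \<open>v\<close>, the map \<open>T\<close> sending \<open>a\<close>
  to \<open>h a *\<^sub>v v\<close> is an isomorphism from the regular module to the column space.
  Its matrix \<open>Y\<close> intertwines \<open>left_mat a\<close> with \<open>h a\<close>, and
  \<open>X\<close> is the inverse of \<open>Y\<close>.\<close>

lemma conjugate_to_left_mat:
  assumes simple: "simple_algebra class_ring A" and h: "h \<in> algebra_hom class_ring A M"
  shows "\<exists>X \<in> Units M. \<forall>a \<in> carrier A. Inn M X (h a) = left_mat a"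
proof -
  note hD = algebra_homD[OF h, simplified module_mat_simps]
  interpret W: vec_space "TYPE('k)" N .
  interpret Mod: algebra_module class_ring A "module_vec TYPE('k) N" "\<lambda>a w. h a *\<^sub>v w"
  proof (intro algebra_module.intro algebra_module_axioms.intro assoc_algebra_axioms vec_vs)
    show "h (a \<otimes> b) *\<^sub>v w = h a *\<^sub>v (h b *\<^sub>v w)"
      if "a \<in> carrier A" "b \<in> carrier A" "w \<in> carrier (module_vec TYPE('k) N)" for a b w
      using that hD(1,2) by (simp add: module_vec_simps assoc_mult_mat_vec[of _ N N _ N])
    show "h (a \<oplus> b) *\<^sub>v w = h a *\<^sub>v w \<oplus>\<^bsub>module_vec TYPE('k) N\<^esub> h b *\<^sub>v w"
      if "a \<in> carrier A" "b \<in> carrier A" "w \<in> carrier (module_vec TYPE('k) N)" for a b w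
      using that hD(1,3) by (simp add: module_vec_simps add_mult_distrib_mat_vec[of _ N N])
    show "h (c \<odot> a) *\<^sub>v w = c \<odot>\<^bsub>module_vec TYPE('k) N\<^esub> (h a *\<^sub>v w)"
      if "a \<in> carrier A" "w \<in> carrier (module_vec TYPE('k) N)" for a w and c :: 'k
      using that hD(1,5) by (simp add: module_vec_simps smult_mat_mult_vec[of _ N N])
    show "h a *\<^sub>v (v \<oplus>\<^bsub>module_vec TYPE('k) N\<^esub> w) = h a *\<^sub>v v \<oplus>\<^bsub>module_vec TYPE('k) N\<^esub> h a *\<^sub>v w"
      if "a \<in> carrier A" "v \<in> carrier (module_vec TYPE('k) N)" "w \<in> carrier (module_vec TYPE('k) N)" for a v w
      using that hD(1) by (simp add: module_vec_simps mult_add_distrib_mat_vec[of _ N N])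
  qed (use hD(1,4) in \<open>auto simp: module_vec_simps mult_mat_vec_carrier[of _ N N]\<close>)
  have "V.dim = W.dim" by (simp add: dim_bs W.dim_is_n)
  then obtain v where v: "v \<in> carrier_vec N"
    and bij: "bij_betw (\<lambda>a. h a *\<^sub>v v) (carrier A) (carrier_vec N)"
    by (rule Mod.ex_cyclic_vector[OF simple fin_dim_bs W.fin_dim, unfolded module_vec_simps])
  define T where "T = (\<lambda>a. h a *\<^sub>v v)"
  have T: "linear_map class_ring A (module_vec TYPE('k) N) T"
    unfolding T_def using Mod.linear_map_act[of v] v by (simp add: module_vec_simps)
  define Y where "Y = mat_of_cols N (map T bs)"
  have Y: "Y \<in> carrier_mat N N" unfolding Y_def using mat_of_cols_carrier(1)[of N "map T bs"] by simp
  have YT: "Y *\<^sub>v coord_vec x = T x" if "x \<in> carrier A" for x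
    unfolding Y_def by (rule mat_of_cols_mult_coord_vec[OF T that])
  \<comment> \<open>A nonzero vector killed by \<open>Y\<close> would be the coordinates of a
    nonzero \<open>x\<close> with \<open>T x\<close> zero, against injectivity of
    \<open>T\<close>.\<close>
  have "det Y \<noteq> 0"
  proof
    assume "det Y = 0"
    then obtain u where u: "u \<in> carrier_vec N" "u \<noteq> 0\<^sub>v N" "Y *\<^sub>v u = 0\<^sub>v N"
      using det_0_iff_vec_prod_zero_field[OF Y] by blast
    then obtain x where x: "x \<in> carrier A" "u = coord_vec x"
      using coord_vec_image by blast
    interpret T: linear_map class_ring A "module_vec TYPE('k) N" T by (rule T)
    interpret C: linear_map class_ring A "module_vec TYPE('k) N" coord_vec by (rule linear_map_coord_vec)
    have "T x = T \<zero>" using YT[OF x(1)] u(3) x(2) T.T0_is_0 by (simp add: module_vec_simps)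
    then have "x = \<zero>" using bij x(1) by (auto simp: T_def bij_betw_def dest: inj_onD)
    then show False using u(2) x(2) C.T0_is_0 by (simp add: module_vec_simps)
  qed
  \<comment> \<open>The determinant criterion is stated for \<open>ring_mat\<close>, whose units are
    those of \<open>M\<close>; \<open>()\<close> only fills its extra record slot.\<close>
  then have YU: "Y \<in> Units M"
    using det_non_zero_imp_unit[OF Y, of "()"]
    by (simp add: Units_def module_mat_simps ring_mat_simps)
  interpret M: ring M using assoc_algebra_mat[where 'k = 'k and N = N] by (simp add: assoc_algebra_def)
  define X where "X = inv\<^bsub>M\<^esub> Y"
  have XU: "X \<in> Units M" and invX: "inv\<^bsub>M\<^esub> X = Y" using YU by (auto simp: X_def)
  have X: "X \<in> carrier_mat N N" using M.Units_closed[OF XU] by (simp add: module_mat_simps)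
  have XY: "X * Y = 1\<^sub>m N" using M.Units_l_inv[OF YU] by (simp add: X_def module_mat_simps)
  have "Inn M X (h a) = left_mat a" if a: "a \<in> carrier A" for a
  proof (rule mat_eqI_coord_vec)
    have ha: "h a \<in> carrier_mat N N" using hD(1) a by simp
    have Inn: "Inn M X (h a) = X * h a * Y" by (simp add: Inn_def invX module_mat_simps)
    show "Inn M X (h a) \<in> carrier_mat N N" using X Y ha by (simp add: Inn)
    fix x assume x: "x \<in> carrier A"
    have "Inn M X (h a) *\<^sub>v coord_vec x = X *\<^sub>v (h a *\<^sub>v T x)"
      using X Y ha x by (simp add: Inn mult_carrier_mat[of _ N N] assoc_mult_mat_vec[of _ N N _ N] YT)
    \<comment> \<open>Equivariance of \<open>T\<close>: acting by \<open>a\<close> on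
      \<open>h x *\<^sub>v v\<close> gives \<open>h (a \<otimes> x) *\<^sub>v v\<close>.\<close>
    also have "h a *\<^sub>v T x = Y *\<^sub>v coord_vec (a \<otimes> x)"
      using a x v hD(1,2) by (simp add: YT T_def assoc_mult_mat_vec[of _ N N _ N])
    also have "X *\<^sub>v (Y *\<^sub>v coord_vec (a \<otimes> x)) = coord_vec (a \<otimes> x)"
      using assoc_mult_mat_vec[OF X Y, of "coord_vec (a \<otimes> x)"] XY by simp
    finally show "Inn M X (h a) *\<^sub>v coord_vec x = left_mat a *\<^sub>v coord_vec x"
      using a x by (simp add: left_mat_mult_coord_vec)
  qed simp
  with XU show ?thesis by blast
qed

end

section \<open>Opposite algebras, inner automorphisms, and the two factors of a tensor
  product\<close>

lemma algebra_hom_opposite: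
  "h \<in> algebra_hom K (opposite_algebra A) B \<Longrightarrow> h \<in> algebra_hom K A (opposite_algebra B)"
  by (auto simp: algebra_hom_def Ring.ring_hom_def opposite_algebra_def)

lemma (in assoc_algebra) Inn_hom:
  assumes X: "X \<in> Units A"
  shows "Inn A X \<in> algebra_hom K A A"
proof (rule algebra_homI)
  have [simp]: "X \<in> carrier A" "inv X \<in> carrier A" using X by auto
  \<comment> \<open>The form in which the inner factors meet once products are associated to the
    right.\<close>
  have XX: "inv X \<otimes> (X \<otimes> y) = y" if "y \<in> carrier A" for y
    using that X by (simp flip: A.m_assoc)
  show "Inn A X (x \<otimes> y) = Inn A X x \<otimes> Inn A X y" if "x \<in> carrier A" "y \<in> carrier A" for x y
    using that by (simp add: Inn_def A.m_assoc XX)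
  show "Inn A X (x \<oplus> y) = Inn A X x \<oplus> Inn A X y" if "x \<in> carrier A" "y \<in> carrier A" for x y
    using that by (simp add: Inn_def A.l_distr A.r_distr)
  show "Inn A X (c \<odot> x) = c \<odot> Inn A X x" if "c \<in> carrier K" "x \<in> carrier A" for c x
    using that by (simp add: Inn_def smult_mult_left smult_mult_right)
  show "Inn A X \<one> = \<one>" using X by (simp add: Inn_def)
qed (use X in \<open>auto simp: Inn_def\<close>)

lemma tensor_left_hom:
  assumes "assoc_algebra class_ring A" "assoc_algebra class_ring B"
  shows "(\<lambda>a. tensor A B a \<one>\<^bsub>B\<^esub>) \<in> algebra_hom class_ring A (tensor_product A B)"
proof -
  interpret B: assoc_algebra class_ring B by fact
  show ?thesis
    by (rule algebra_homI)
      (simp_all add: tensor_closed tensor_mult tensor_one tensor_add_left tensor_smult(1) assms)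
qed

lemma tensor_right_hom:
  assumes "assoc_algebra class_ring A" "assoc_algebra class_ring B"
  shows "(\<lambda>b. tensor A B \<one>\<^bsub>A\<^esub> b) \<in> algebra_hom class_ring B (tensor_product A B)"
proof -
  interpret A: assoc_algebra class_ring A by fact
  show ?thesis
    by (rule algebra_homI)
      (simp_all add: tensor_closed tensor_mult tensor_one tensor_add_right tensor_smult(2) assms)
qed

lemma central_simple_imp_simple: "central_simple K A \<Longrightarrow> simple_algebra K A"
  by (simp add: central_simple_def simple_algebra_def)

lemma algebra_degree_eq_dim:
  assumes "algebra_degree K A = real n"
  shows "vectorspace.dim K A = n\<^sup>2"
proof -
  have "(sqrt (real (vectorspace.dim K A)))\<^sup>2 = (real n)\<^sup>2"
    using assms by (simp add: algebra_degree_def)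
  then have "real (vectorspace.dim K A) = real (n\<^sup>2)" by simp
  then show ?thesis by (simp only: of_nat_eq_iff)
qed

text \<open>HOL functions are total, so agreement with \<open>L\<close> is asked on
  \<open>carrier A\<^sub>1\<close> only. The second half covers every conjugating \<open>X\<close>,
  not just a constructed one. The injectivity conclusions make each \<open>inv_into\<close> a
  genuine inverse on the image.\<close>

theorem mainTheorem2:
  fixes A\<^sub>1 :: "('k::field, 'a) module" and A\<^sub>2 :: "('k, 'b) module" and n :: nat
    and M :: "('k, 'k mat) module"
    and \<phi> :: "(('a \<times> 'b) \<Rightarrow>\<^sub>0 'k) set \<Rightarrow> 'k mat"
    and \<phi>\<^sub>1 :: "'a \<Rightarrow> 'k mat" and \<phi>\<^sub>2 :: "'b \<Rightarrow> 'k mat"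
    and bs :: "'a list" and L \<rho> :: "'a \<Rightarrow> 'k mat"
  assumes "central_simple class_ring A\<^sub>1" "vectorspace.fin_dim class_ring A\<^sub>1"
      "algebra_degree class_ring A\<^sub>1 = real n"
    and "central_simple class_ring A\<^sub>2" "vectorspace.fin_dim class_ring A\<^sub>2"
      "algebra_degree class_ring A\<^sub>2 = real n"
    and "M = mat_algebra TYPE('k) (n\<^sup>2)"
    and "\<phi> \<in> algebra_iso class_ring (tensor_product A\<^sub>1 (opposite_algebra A\<^sub>2)) M"
    and "\<phi>\<^sub>1 = (\<lambda>a. \<phi> (tensor A\<^sub>1 (opposite_algebra A\<^sub>2) a \<one>\<^bsub>opposite_algebra A\<^sub>2\<^esub>))"
    and "\<phi>\<^sub>2 = (\<lambda>b. \<phi> (tensor A\<^sub>1 (opposite_algebra A\<^sub>2) \<one>\<^bsub>A\<^sub>1\<^esub> b))"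
    and "ordered_basis class_ring A\<^sub>1 bs"
    and "L = (\<lambda>a. matrix_of_end class_ring A\<^sub>1 bs (left_regular A\<^sub>1 a))"
    and "\<rho> = (\<lambda>a. matrix_of_end class_ring A\<^sub>1 bs (right_regular A\<^sub>1 a))"
  shows "(\<exists>X \<in> Units M. \<forall>a \<in> carrier A\<^sub>1. (Inn M X \<circ> \<phi>\<^sub>1) a = L a) \<and>
    (\<forall>X \<in> Units M. (\<forall>a \<in> carrier A\<^sub>1. (Inn M X \<circ> \<phi>\<^sub>1) a = L a) \<longrightarrow>
      (let \<phi>\<^sub>2' = Inn M X \<circ> \<phi>\<^sub>2;
           \<chi> = inv_into (carrier A\<^sub>2) \<phi>\<^sub>2' \<circ> \<rho>;
           \<chi>' = inv_into (carrier A\<^sub>1) \<rho> \<circ> \<phi>\<^sub>2'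
       in inj_on \<phi>\<^sub>2' (carrier A\<^sub>2) \<and> inj_on \<rho> (carrier A\<^sub>1) \<and>
          \<phi>\<^sub>2' ` carrier A\<^sub>2 = \<rho> ` carrier A\<^sub>1 \<and>
          \<chi> \<in> algebra_iso class_ring A\<^sub>1 A\<^sub>2 \<and>
          \<chi>' \<in> algebra_iso class_ring A\<^sub>2 A\<^sub>1))"
proof -
  let ?B = "opposite_algebra A\<^sub>2"
  let ?T = "tensor_product A\<^sub>1 ?B"
  have s1: "simple_algebra class_ring A\<^sub>1" and s2: "simple_algebra class_ring A\<^sub>2"
    using assms(1,4) by (simp_all add: central_simple_imp_simple)
  then have alg1: "assoc_algebra class_ring A\<^sub>1" and alg2: "assoc_algebra class_ring A\<^sub>2"
    by (simp_all add: simple_algebra_def)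
  have algB: "assoc_algebra class_ring ?B" using alg2 by (rule assoc_algebra_opposite)
  interpret A1: assoc_algebra class_ring A\<^sub>1 by (fact alg1)
  interpret A1: based_algebra A\<^sub>1 bs
    by (intro based_algebra.intro based_space.intro based_space_axioms.intro alg1 assms(11)
        A1.V.vectorspace_axioms)
  interpret B: assoc_algebra class_ring ?B by (fact algB)
  have N: "length bs = n\<^sup>2"
    using algebra_degree_eq_dim[OF assms(3)] A1.dim_bs by simp
  have M: "M = mat_algebra TYPE('k) (length bs)" using assms(7) N by simp
  have algM: "assoc_algebra class_ring M" unfolding M by (rule assoc_algebra_mat)
  interpret M: assoc_algebra class_ring M by (fact algM)
  have algMo: "assoc_algebra class_ring (opposite_algebra M)"
    using algM by (rule assoc_algebra_opposite)
  have hom: "\<phi> \<in> algebra_hom class_ring ?T M"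
    using assms(8) by (simp add: algebra_iso_def algebra_hom_def ring_iso_def)
  have hom1: "\<phi>\<^sub>1 \<in> algebra_hom class_ring A\<^sub>1 M"
    using algebra_hom_comp[OF tensor_left_hom[OF alg1 algB] hom] unfolding assms(9) comp_def .
  have hom2: "\<phi>\<^sub>2 \<in> algebra_hom class_ring ?B M"
    using algebra_hom_comp[OF tensor_right_hom[OF alg1 algB] hom] unfolding assms(10) comp_def .
  have rho_hom: "\<rho> \<in> algebra_hom class_ring A\<^sub>1 (opposite_algebra M)"
    and rho_inj: "inj_on \<rho> (carrier A\<^sub>1)"
    using A1.right_mat_hom A1.inj_right_mat unfolding assms(13) M by simp_all
  have "\<exists>X \<in> Units M. \<forall>a \<in> carrier A\<^sub>1. (Inn M X \<circ> \<phi>\<^sub>1) a = L a"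
    using A1.conjugate_to_left_mat[OF s1 hom1[unfolded M]] unfolding assms(12) M comp_apply .
  moreover have "inj_on (Inn M X \<circ> \<phi>\<^sub>2) (carrier A\<^sub>2) \<and> inj_on \<rho> (carrier A\<^sub>1) \<and>
      (Inn M X \<circ> \<phi>\<^sub>2) ` carrier A\<^sub>2 = \<rho> ` carrier A\<^sub>1 \<and>
      inv_into (carrier A\<^sub>2) (Inn M X \<circ> \<phi>\<^sub>2) \<circ> \<rho> \<in> algebra_iso class_ring A\<^sub>1 A\<^sub>2 \<and>
      inv_into (carrier A\<^sub>1) \<rho> \<circ> (Inn M X \<circ> \<phi>\<^sub>2) \<in> algebra_iso class_ring A\<^sub>2 A\<^sub>1"
    if X: "X \<in> Units M" and conj: "\<forall>a \<in> carrier A\<^sub>1. (Inn M X \<circ> \<phi>\<^sub>1) a = L a" for X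
  proof -
    define \<phi>\<^sub>2' where "\<phi>\<^sub>2' = Inn M X \<circ> \<phi>\<^sub>2"
    \<comment> \<open>The reversal of products moves from the source to the target, so that
      \<open>\<phi>\<^sub>2'\<close> and \<open>\<rho>\<close> map into the same algebra.\<close>
    have hom2': "\<phi>\<^sub>2' \<in> algebra_hom class_ring A\<^sub>2 (opposite_algebra M)"
      unfolding \<phi>\<^sub>2'_def by (intro algebra_hom_opposite algebra_hom_comp[OF hom2] M.Inn_hom X)
    \<comment> \<open>This excludes matrices of size zero, where one and zero coincide. An empty
      basis would make all coordinate vectors equal and \<open>A\<^sub>1\<close> zero.\<close>
    have "length bs \<noteq> 0"
    proof
      assume "length bs = 0"
      then have "A1.coord_vec x = A1.coord_vec \<zero>\<^bsub>A\<^sub>1\<^esub>" for x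
        unfolding A1.coord_vec_def by (intro eq_vecI) auto
      then have "x = \<zero>\<^bsub>A\<^sub>1\<^esub>" if "x \<in> carrier A\<^sub>1" for x
        using inj_onD[OF A1.inj_coord_vec _ that A1.A.zero_closed] by blast
      then show False
        using s1 A1.A.zero_closed unfolding simple_algebra_def by blast
    qed
    then have "\<one>\<^bsub>opposite_algebra M\<^esub> $$ (0, 0) \<noteq> \<zero>\<^bsub>opposite_algebra M\<^esub> $$ (0, 0)"
      by (simp add: opposite_algebra_def M module_mat_simps)
    then have "\<one>\<^bsub>opposite_algebra M\<^esub> \<noteq> \<zero>\<^bsub>opposite_algebra M\<^esub>" by metis
    then have inj2: "inj_on \<phi>\<^sub>2' (carrier A\<^sub>2)"
      by (rule simple_algebra_hom_inj[OF s2 hom2' algMo])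
    have psi: "Inn M X \<circ> \<phi> \<in> algebra_hom class_ring ?T M"
      by (intro algebra_hom_comp[OF hom] M.Inn_hom X)
    have sub: "\<phi>\<^sub>2' ` carrier A\<^sub>2 \<subseteq> \<rho> ` carrier A\<^sub>1"
    proof (rule image_subsetI)
      fix b assume "b \<in> carrier A\<^sub>2"
      then have b: "b \<in> carrier ?B" by (simp add: opposite_algebra_def)
      have "\<phi>\<^sub>2' b \<otimes>\<^bsub>M\<^esub> L a = L a \<otimes>\<^bsub>M\<^esub> \<phi>\<^sub>2' b" if a: "a \<in> carrier A\<^sub>1" for a
      proof -
        let ?t = "tensor A\<^sub>1 ?B"
        have t: "?t a \<one>\<^bsub>?B\<^esub> \<in> carrier ?T" "?t \<one>\<^bsub>A\<^sub>1\<^esub> b \<in> carrier ?T"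
          using a b by (simp_all add: tensor_closed[OF alg1 algB])
        \<comment> \<open>Both products equal \<open>?t a b\<close>, so the two tensor factors
          commute, and so do their images under the conjugated map.\<close>
        have "?t \<one>\<^bsub>A\<^sub>1\<^esub> b \<otimes>\<^bsub>?T\<^esub> ?t a \<one>\<^bsub>?B\<^esub> = ?t a \<one>\<^bsub>?B\<^esub> \<otimes>\<^bsub>?T\<^esub> ?t \<one>\<^bsub>A\<^sub>1\<^esub> b"
          using a b by (simp add: tensor_mult[OF alg1 algB])
        then have "(Inn M X \<circ> \<phi>) (?t \<one>\<^bsub>A\<^sub>1\<^esub> b) \<otimes>\<^bsub>M\<^esub> (Inn M X \<circ> \<phi>) (?t a \<one>\<^bsub>?B\<^esub>) =
            (Inn M X \<circ> \<phi>) (?t a \<one>\<^bsub>?B\<^esub>) \<otimes>\<^bsub>M\<^esub> (Inn M X \<circ> \<phi>) (?t \<one>\<^bsub>A\<^sub>1\<^esub> b)"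
          using algebra_homD(2)[OF psi] t by metis
        moreover have "L a = (Inn M X \<circ> \<phi>) (?t a \<one>\<^bsub>?B\<^esub>)"
          using bspec[OF conj a] by (simp add: assms(9))
        moreover have "\<phi>\<^sub>2' b = (Inn M X \<circ> \<phi>) (?t \<one>\<^bsub>A\<^sub>1\<^esub> b)"
          by (simp add: \<phi>\<^sub>2'_def assms(10))
        ultimately show ?thesis by simp
      qed
      moreover have "\<phi>\<^sub>2' b \<in> carrier M"
        using algebra_homD(1)[OF hom2', of b] \<open>b \<in> carrier A\<^sub>2\<close> by (simp add: opposite_algebra_def)
      ultimately show "\<phi>\<^sub>2' b \<in> \<rho> ` carrier A\<^sub>1"
        unfolding assms(12,13) M module_mat_simps by (intro A1.commutant_left_mat)
    qed
    \<comment> \<open>The inclusion \<open>sub\<close> becomes an equality because both maps are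
      injective and both algebras have dimension \<open>n\<^sup>2\<close>.\<close>
    have img: "\<phi>\<^sub>2' ` carrier A\<^sub>2 = \<rho> ` carrier A\<^sub>1"
    proof (rule linear_inj_images_eq)
      show "linear_map class_ring A\<^sub>1 (opposite_algebra M) \<rho>"
        by (rule algebra_hom_linear_map[OF rho_hom alg1 algMo])
      show "linear_map class_ring A\<^sub>2 (opposite_algebra M) \<phi>\<^sub>2'"
        by (rule algebra_hom_linear_map[OF hom2' alg2 algMo])
      show "vectorspace.dim class_ring A\<^sub>1 = vectorspace.dim class_ring A\<^sub>2"
        by (simp only: algebra_degree_eq_dim[OF assms(3)] algebra_degree_eq_dim[OF assms(6)])
    qed (fact rho_inj assms(2) inj2 assms(5) sub)+
    have "inv_into (carrier A\<^sub>2) \<phi>\<^sub>2' \<circ> \<rho> \<in> algebra_iso class_ring A\<^sub>1 A\<^sub>2"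
      by (rule algebra_iso_inv_into_comp[OF alg2 alg1 hom2' inj2 rho_hom rho_inj img[symmetric]])
    moreover have "inv_into (carrier A\<^sub>1) \<rho> \<circ> \<phi>\<^sub>2' \<in> algebra_iso class_ring A\<^sub>2 A\<^sub>1"
      by (rule algebra_iso_inv_into_comp[OF alg1 alg2 rho_hom rho_inj hom2' inj2 img])
    ultimately show ?thesis
      using inj2 rho_inj img unfolding \<phi>\<^sub>2'_def by blast
  qed
  ultimately show ?thesis unfolding Let_def by blast
qed

end
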